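(* Let $G$ be a graph on $n$ vertices (not necessarily connected) with second largest eigenvalue $\lambda_2$, and let $\Delta$ satisfy $\Delta \ge \Delta(G) \ge 2$. Then $$m_G(\lambda_2) \le 5n \cdot \max\left\{ \frac{\log(\lambda_2+1)}{\lambda_2},\ \frac{\log^2(1+\log_\Delta n)}{\log_\Delta n}\right\}.$$ Moreover, for any $0<\varepsilon \le 1$, if $\log_\Delta n \ge \varepsilon^{-1}(2\lambda_2+2)^{14}\log(\lambda_2+2)$, then $$m_G(\lambda_2) \le \frac{n}{\lambda_2+1} + n^{\varepsilon}.$$
   Context: All graphs are finite and simple; eigenvalues are those of the adjacency matrix, $\Delta(G)$ is the maximum degree, and $m_G(\lambda)$ denotes the multiplicity of $\lambda$ as an eigenvalue of $G$. $\log$ is base $2$ and $\log_\Delta n = \log n/\log\Delta$.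
   Formalization: The first inequality is stated for Δ ≤ n, since it fails for huge Δ (e.g. large Paley graphs); where undefined, log(λ_2+1)/λ_2 is read as its limit (log e at λ_2 = 0, +∞ at λ_2 = −1), and n/(λ_2+1) as +∞ at λ_2 = −1. *)

theory Defs
  imports "HOL-Analysis.Analysis" "HOL-Library.Multiset" "HOL-Real_Asymp.Real_Asymp"
begin

definition simple_graph :: "('v::finite \<Rightarrow> 'v \<Rightarrow> bool) \<Rightarrow> bool" where
  "simple_graph E \<longleftrightarrow> symp E \<and> irreflp E"

definition max_degree :: "('v::finite \<Rightarrow> 'v \<Rightarrow> bool) \<Rightarrow> nat" where
  "max_degree E = Max (range (\<lambda>v. card {w. E v w}))"

definition adj_matrix :: "('v::finite \<Rightarrow> 'v \<Rightarrow> bool) \<Rightarrow> real^'v^'v" where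
  "adj_matrix E = (\<chi> v w. if E v w then 1 else 0)"

definition eigenvalues :: "('v::finite \<Rightarrow> 'v \<Rightarrow> bool) \<Rightarrow> real set" where
  "eigenvalues E = {\<mu>. \<exists>x. x \<noteq> 0 \<and> adj_matrix E *v x = \<mu> *\<^sub>R x}"

text \<open>The adjacency matrix is symmetric, so its geometric and algebraic multiplicities agree.\<close>

definition eig_mult :: "('v::finite \<Rightarrow> 'v \<Rightarrow> bool) \<Rightarrow> real \<Rightarrow> nat" where
  "eig_mult E \<mu> = dim {x. adj_matrix E *v x = \<mu> *\<^sub>R x}"

definition spectrum_desc :: "('v::finite \<Rightarrow> 'v \<Rightarrow> bool) \<Rightarrow> real list" where
  "spectrum_desc E =
     rev (sorted_list_of_multiset (\<Sum>\<mu>\<in>eigenvalues E. replicate_mset (eig_mult E \<mu>) \<mu>))"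

text \<open>Eigenvalues are counted with multiplicity, so the second eigenvalue coincides with the first
  one when the largest eigenvalue is not simple.\<close>

definition second_eigenvalue :: "('v::finite \<Rightarrow> 'v \<Rightarrow> bool) \<Rightarrow> real" where
  "second_eigenvalue E = spectrum_desc E ! 1"

text \<open>The quotient \<open>log (x + 1) / x\<close> for \<open>x \<ge> -1\<close>, extended by its limits: \<open>log e\<close> at \<open>0\<close> and
  \<open>\<infinity>\<close> at \<open>-1\<close>. Both arguments occur as second eigenvalues (of complete multipartite graphs, possibly
  with isolated vertices, and of complete graphs respectively), and the value \<open>0\<close> that the total
  functions \<^term>\<open>log\<close> and \<open>/\<close> on the reals yield there is not the intended one.\<close>

definition log_quotient :: "real \<Rightarrow> ereal" where
  "log_quotient x =
     (if x \<le> -1 then \<infinity> else if x = 0 then ereal (log 2 (exp 1)) else ereal (log 2 (x + 1) / x))"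

lemma log_quotient_limit:
  assumes "x \<ge> -1"
  shows "((\<lambda>y. ereal (log 2 (y + 1) / y)) \<longlongrightarrow> log_quotient x) (at x within {-1<..})"
proof -
  consider "x = -1" | "x = 0" | "x > -1" "x \<noteq> 0" using assms by linarith
  then show ?thesis
  proof cases
    case 1
    have "filterlim (\<lambda>y::real. log 2 (y + 1) / y) at_top (at_right (-1))"
      by real_asymp
    then show ?thesis
      using 1 by (simp add: log_quotient_def tendsto_PInfty_eq_at_top)
  next
    case 2
    have "((\<lambda>y::real. log 2 (y + 1) / y) \<longlongrightarrow> log 2 (exp 1)) (at 0)"
      by (simp add: log_def, real_asymp simp: divide_simps)
    then show ?thesis
      using 2 by (auto simp: log_quotient_def intro: tendsto_within_subset)
  next
    case 3
    have "((\<lambda>y::real. log 2 (y + 1) / y) \<longlongrightarrow> log 2 (x + 1) / x) (at x within {-1<..})"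
      using 3 by (intro tendsto_intros) auto
    then show ?thesis
      using 3 by (simp add: log_quotient_def)
  qed
qed

end

theory Submission
  imports Defs
begin

text \<open>
  Two disjoint sets without edges between them cannot both have a Rayleigh quotient above
  \<open>\<lambda> = \<lambda>\<^sub>2\<close>. Hence the vertices \<open>v\<close> whose ball of radius \<open>s\<close> has a Rayleigh quotient above \<open>\<lambda>\<close>
  lie in one ball of radius \<open>2 s + 1\<close>, and there are few of them. Deleting a set of vertices lowers
  the dimension of the eigenspace by at most its size, and by Bessel's inequality the dimension that
  survives is at most \<open>\<lambda>\<close> to the power \<open>- 2 s\<close> times the number of closed walks of length \<open>2 s\<close> in
  the remaining graph, each of which stays in a ball of radius \<open>s\<close>.

  For the first bound a random set of vertices is deleted in addition: it destroys most of the walks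
  that visit many vertices, and there are few walks that visit only a few.

  For the second bound, a component all of whose Rayleigh quotients are at most \<open>\<lambda>\<close> contributes at
  most one dimension, and only if it has at least \<open>\<lambda> + 1\<close> vertices. By the first remark there is at
  most one other component. In it, a maximal packing of balls of radius \<open>3\<close> with at least \<open>\<lambda> + 2\<close>
  vertices is deleted. Near it the deletion lowers the largest eigenvalue, and away from it all
  degrees are less than \<open>\<lambda> - 1\<close>, so that every ball in the remaining graph has its largest
  eigenvalue bounded away from \<open>\<lambda>\<close>.
\<close>

text \<open>In a ball whose Rayleigh quotients are at most \<lambda> there can be about \<lambda>^(2
  s) closed walks at each vertex, so Bessel's inequality alone gives no more than n. Both bounds
  come from gaining a factor over this. For the first, vertices are deleted with probability p, and
  walks are split by whether they visit more than m vertices. Destroying the long-ranging ones takes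
  m of order log(1/p)/p. The others are few only if m is below a fraction of \<lambda> and m log(1 +
  L) below a fraction of L, where L = log_\<Delta> n limits the radius s. Solved for p, these two
  constraints are the two terms of the maximum. For the second, the leading coefficient is exactly
  1, so deletions must fit a budget: the packing takes a share 1/(\<lambda> + 2) of the component,
  which leaves 1/((\<lambda> + 1)(\<lambda> + 2)) for the surviving eigenspace. The gap obtained is
  of order \<lambda>^(-13), relative to \<lambda> of order \<lambda>^(-14), and about \<lambda>^14
  log \<lambda> steps turn it into that share; hence the exponent 14.\<close>

section \<open>Rayleigh quotients of symmetric matrices\<close>

lemma sym_dot:
  fixes B :: "real^'v^'v"
  assumes "transpose B = B"
  shows "(B *v x) \<bullet> y = x \<bullet> (B *v y)"
  by (metis assms dot_lmul_matrix vector_transpose_matrix)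

text \<open>First-order condition at a maximiser: moving from \<open>x\<close> in the direction of
  the residual \<open>z\<close> changes the slack by \<open>2 * t * (z \<bullet> z)\<close> to first
  order, and a small negative \<open>t\<close> would make it negative. Invariance of
  \<open>W\<close> keeps the residual inside \<open>W\<close>.\<close>

lemma maximizer_eigenvector:
  fixes B :: "real^'v^'v"
  assumes B: "transpose B = B" and W: "subspace W" and inv: "\<And>y. y \<in> W \<Longrightarrow> B *v y \<in> W"
    and le: "\<And>y. y \<in> W \<Longrightarrow> y \<bullet> (B *v y) \<le> \<mu> * (y \<bullet> y)"
    and x: "x \<in> W" "x \<bullet> (B *v x) = \<mu> * (x \<bullet> x)"
  shows "B *v x = \<mu> *\<^sub>R x"
proof -
  define z where "z = \<mu> *\<^sub>R x - B *v x"
  have zW: "z \<in> W" unfolding z_def using W inv x(1) by (simp add: subspace_diff subspace_scale)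
  define q where "q = \<mu> * (z \<bullet> z) - z \<bullet> (B *v z)"
  have key: "0 \<le> 2 * t * (z \<bullet> z) + t\<^sup>2 * q" for t :: real
  proof -
    have "(x + t *\<^sub>R z) \<bullet> (B *v (x + t *\<^sub>R z)) \<le> \<mu> * ((x + t *\<^sub>R z) \<bullet> (x + t *\<^sub>R z))"
      using le W x(1) zW by (simp add: subspace_add subspace_scale)
    moreover have bzx: "z \<bullet> (B *v x) = x \<bullet> (B *v z)"
      using sym_dot[OF B, of z x] by (simp add: inner_commute)
    moreover have "(x + t *\<^sub>R z) \<bullet> (B *v (x + t *\<^sub>R z))
        = x \<bullet> (B *v x) + 2 * t * (x \<bullet> (B *v z)) + t\<^sup>2 * (z \<bullet> (B *v z))"
      by (simp add: matrix_vector_right_distrib matrix_vector_mult_scaleR inner_add_left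
          inner_add_right bzx algebra_simps power2_eq_square)
    moreover have "\<mu> * ((x + t *\<^sub>R z) \<bullet> (x + t *\<^sub>R z))
        = \<mu> * (x \<bullet> x) + 2 * t * (\<mu> * (x \<bullet> z)) + t\<^sup>2 * (\<mu> * (z \<bullet> z))"
      by (simp add: inner_add_left inner_add_right inner_commute[of z x] algebra_simps power2_eq_square)
    moreover have "z \<bullet> z = \<mu> * (x \<bullet> z) - x \<bullet> (B *v z)"
      using sym_dot[OF B, of x z] by (simp add: z_def inner_diff_left)
    then have "2 * t * (z \<bullet> z) = 2 * t * (\<mu> * (x \<bullet> z)) - 2 * t * (x \<bullet> (B *v z))"
      by (simp only: right_diff_distrib)
    ultimately show ?thesis
      using x(2) unfolding q_def right_diff_distrib by linarith
  qed
  have "z \<bullet> z = 0"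
  proof (rule ccontr)
    assume "z \<bullet> z \<noteq> 0"
    then have p: "z \<bullet> z > 0" by (metis inner_ge_zero order_le_less)
    define d where "d = 1 + \<bar>q\<bar>"
    have d: "d > 0" "q < d" by (auto simp: d_def)
    define t where "t = - (z \<bullet> z) / d"
    have "2 * t * (z \<bullet> z) + t\<^sup>2 * q = (z \<bullet> z)\<^sup>2 / d * (q / d - 2)"
      unfolding t_def using d by (simp add: power2_eq_square field_simps)
    moreover have "q / d - 2 < 0" using d by (simp add: field_simps)
    moreover have "(z \<bullet> z)\<^sup>2 / d > 0" using p d by simp
    ultimately show False using key[of t] by (metis mult_pos_neg not_less)
  qed
  then show ?thesis by (simp add: z_def)
qed

text \<open>The subspace \<open>W\<close> is a parameter so that the lemma can be applied first to
  the whole space and then to the orthogonal complement of the eigenvector found there.\<close>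

lemma rayleigh_maximum:
  fixes B :: "real^'v^'v"
  assumes B: "transpose B = B" and W: "subspace W" and inv: "\<And>y. y \<in> W \<Longrightarrow> B *v y \<in> W"
    and w: "w \<in> W" "w \<noteq> 0"
  obtains x \<mu> where "x \<in> W" "norm x = 1" "B *v x = \<mu> *\<^sub>R x"
    "\<And>y. y \<in> W \<Longrightarrow> y \<bullet> (B *v y) \<le> \<mu> * (y \<bullet> y)"
proof -
  have c: "compact (sphere 0 1 \<inter> W)"
    by (intro compact_Int_closed closed_subspace W) auto
  have ne: "sphere 0 1 \<inter> W \<noteq> {}"
  proof -
    have "(1 / norm w) *\<^sub>R w \<in> sphere 0 1 \<inter> W"
      using w W by (simp add: subspace_scale)
    then show ?thesis by blast
  qed
  have cont: "continuous_on (sphere 0 1 \<inter> W) (\<lambda>y. y \<bullet> (B *v y))"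
    by (intro continuous_intros linear_continuous_on linear_linear[THEN iffD2]
        matrix_vector_mul_linear)
  obtain x where x: "x \<in> sphere 0 1 \<inter> W"
    and mx: "\<And>y. y \<in> sphere 0 1 \<inter> W \<Longrightarrow> y \<bullet> (B *v y) \<le> x \<bullet> (B *v x)"
    using continuous_attains_sup[OF c ne cont] by auto
  define \<mu> where "\<mu> = x \<bullet> (B *v x)"
  have le: "y \<bullet> (B *v y) \<le> \<mu> * (y \<bullet> y)" if "y \<in> W" for y
  proof (cases "y = 0")
    case False
    have "(1 / norm y) *\<^sub>R y \<in> sphere 0 1 \<inter> W"
      using that W False by (auto simp: subspace_scale)
    from mx[OF this] have "(y \<bullet> (B *v y)) / (norm y)\<^sup>2 \<le> \<mu>"
      by (simp add: \<mu>_def matrix_vector_mult_scaleR power2_eq_square)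
    then show ?thesis using False by (simp add: divide_le_eq dot_square_norm)
  qed simp
  have "B *v x = \<mu> *\<^sub>R x"
    by (rule maximizer_eigenvector[OF B W inv le]) (use x in \<open>auto simp: \<mu>_def dot_square_norm\<close>)
  then show ?thesis using that x le by auto
qed

lemma eigenvectors_orthogonal:
  fixes B :: "real^'v^'v"
  assumes "transpose B = B" "B *v x = a *\<^sub>R x" "B *v y = b *\<^sub>R y" "a \<noteq> b"
  shows "x \<bullet> y = 0"
  using sym_dot[OF assms(1), of x y] assms by auto

section \<open>Induced subgraphs and the second eigenvalue\<close>

text \<open>Rows and columns outside \<open>X\<close> are zeroed rather than removed, so that the
  operators of different vertex sets act on one space and can be compared entrywise.\<close>

definition adj_on :: "('v::finite \<Rightarrow> 'v \<Rightarrow> bool) \<Rightarrow> 'v set \<Rightarrow> real^'v^'v" where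
  "adj_on E X = (\<chi> v w. if v \<in> X \<and> w \<in> X \<and> E v w then 1 else 0)"

text \<open>For symmetric \<open>E\<close>: no eigenvalue of the induced subgraph exceeds
  \<open>c\<close>. Phrased through the quadratic form, the bound passes to subsets by restricting
  vectors.\<close>

definition rayleigh_le :: "('v::finite \<Rightarrow> 'v \<Rightarrow> bool) \<Rightarrow> 'v set \<Rightarrow> real \<Rightarrow> bool" where
  "rayleigh_le E X c \<longleftrightarrow> (\<forall>x. x \<bullet> (adj_on E X *v x) \<le> c * (x \<bullet> x))"

lemma adj_on_UNIV: "adj_on E UNIV = adj_matrix E"
  by (simp add: adj_on_def adj_matrix_def)

lemma transpose_adj_on: "simple_graph E \<Longrightarrow> transpose (adj_on E X) = adj_on E X"
  by (auto simp: adj_on_def transpose_def simple_graph_def vec_eq_iff symp_def)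

lemma adj_on_nth: "(adj_on E X *v x) $ v = (if v \<in> X then \<Sum>w\<in>{w\<in>X. E v w}. x $ w else 0)"
  by (auto simp: adj_on_def matrix_vector_mult_def sum.If_cases if_distrib[of "\<lambda>c. c * _"] Int_def
      cong: if_cong intro!: sum.cong)

text \<open>Guards the sum in \<open>spectrum_desc\<close>, which would collapse to the empty
  multiset over an infinite index set.\<close>

lemma finite_eigenvalues:
  assumes "simple_graph E"
  shows "finite (eigenvalues E)"
proof -
  have T: "transpose (adj_matrix E) = adj_matrix E"
    using transpose_adj_on[OF assms, of UNIV] by (simp add: adj_on_UNIV)
  define f where "f \<mu> = (SOME x. x \<noteq> 0 \<and> adj_matrix E *v x = \<mu> *\<^sub>R x)" for \<mu>
  have f: "f \<mu> \<noteq> 0 \<and> adj_matrix E *v f \<mu> = \<mu> *\<^sub>R f \<mu>" if "\<mu> \<in> eigenvalues E" for \<mu>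
    unfolding f_def by (rule someI_ex) (use that in \<open>auto simp: eigenvalues_def\<close>)
  have orth: "f a \<bullet> f b = 0" if "a \<in> eigenvalues E" "b \<in> eigenvalues E" "a \<noteq> b" for a b
    using eigenvectors_orthogonal[OF T] f that by metis
  have inj: "inj_on f (eigenvalues E)"
    by (rule inj_onI) (metis f inner_eq_zero_iff orth)
  have "pairwise orthogonal (f ` eigenvalues E)"
    unfolding pairwise_def orthogonal_def using orth by fastforce
  then have "independent (f ` eigenvalues E)"
    by (rule pairwise_orthogonal_independent) (use f in auto)
  then show ?thesis
    using inj independent_imp_finite finite_imageD by blast
qed

lemma second_entry_greater:
  fixes M :: "real multiset"
  assumes "size (filter_mset (\<lambda>x. x > c) M) \<ge> 2"
  shows "rev (sorted_list_of_multiset M) ! 1 > c"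
proof (rule ccontr)
  define l where "l = rev (sorted_list_of_multiset M)"
  assume "\<not> rev (sorted_list_of_multiset M) ! 1 > c"
  then have le: "l ! 1 \<le> c" by (simp add: l_def)
  have ml: "mset l = M" by (simp add: l_def)
  have len: "length l \<ge> 2"
    using assms size_filter_mset_lesseq[of "\<lambda>x. x > c" M] ml by (metis le_trans size_mset)
  then obtain a b l' where l: "l = a # b # l'"
    by (cases l; cases "tl l") auto
  have "sorted (rev l)" by (simp add: l_def)
  then have "\<forall>y\<in>set l'. y \<le> b" unfolding l by (auto simp: sorted_append)
  then have f: "filter_mset (\<lambda>x. x > c) (mset l') = {#}"
    using le l by (auto simp: not_less dest: order_trans)
  then have "size (filter_mset (\<lambda>x. x > c) M) \<le> 1"
    unfolding ml[symmetric] l using le l by (simp add: f)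
  then show False using assms by simp
qed

lemma second_eigenvalue_greater:
  assumes E: "simple_graph E"
    and xy: "adj_matrix E *v x = a *\<^sub>R x" "adj_matrix E *v y = b *\<^sub>R y" "x \<bullet> y = 0" "x \<noteq> 0" "y \<noteq> 0"
    and ab: "a > c" "b > c"
  shows "second_eigenvalue E > c"
proof -
  let ?S = "\<lambda>\<mu>. {x. adj_matrix E *v x = \<mu> *\<^sub>R x}"
  have sub: "subspace (?S \<mu>)" for \<mu>
    by (auto simp: subspace_def matrix_vector_right_distrib scaleR_right_distrib
        matrix_vector_mult_scaleR)
  have fin: "finite (eigenvalues E)" by (rule finite_eigenvalues[OF E])
  have mem: "a \<in> eigenvalues E" "b \<in> eigenvalues E" using xy by (auto simp: eigenvalues_def)
  have pos: "dim (?S \<mu>) \<ge> 1" if "z \<in> ?S \<mu>" "z \<noteq> 0" for z \<mu>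
  proof -
    have "\<not> ?S \<mu> \<subseteq> {0}" using that by blast
    then have "dim (?S \<mu>) \<noteq> 0" unfolding dim_eq_0 .
    then show ?thesis by linarith
  qed
  let ?F = "\<lambda>\<mu>. size (filter_mset (\<lambda>x. x > c) (replicate_mset (eig_mult E \<mu>) \<mu>))"
  have F: "?F \<mu> = (if \<mu> > c then eig_mult E \<mu> else 0)" for \<mu>
  proof -
    have "size (filter_mset (\<lambda>x. x > c) (replicate_mset k \<mu>)) = (if \<mu> > c then k else 0)" for k
      by (induction k) auto
    then show ?thesis .
  qed
  \<comment> \<open>For \<open>a = b\<close> the orthogonality of \<open>x\<close> and
    \<open>y\<close> makes this eigenvalue count twice; otherwise each of the two contributes at
    least once.\<close>
  have two: "2 \<le> (\<Sum>\<mu>\<in>eigenvalues E. ?F \<mu>)"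
  proof (cases "a = b")
    case True
    have xney: "x \<noteq> y" using xy by auto
    have "independent {x, y}"
      by (rule pairwise_orthogonal_independent)
        (use xy in \<open>auto simp: pairwise_def orthogonal_def inner_commute\<close>)
    then have "card {x, y} \<le> dim (?S a)"
      by (intro independent_card_le_dim) (use xy True in auto)
    then have "2 \<le> eig_mult E a" using xney by (simp add: eig_mult_def)
    also have "\<dots> = ?F a" using ab by (simp add: F)
    also have "\<dots> \<le> (\<Sum>\<mu>\<in>eigenvalues E. ?F \<mu>)" by (rule member_le_sum) (use mem fin in auto)
    finally show ?thesis .
  next
    case False
    have "2 \<le> eig_mult E a + eig_mult E b"
      using pos[of x a] pos[of y b] xy unfolding eig_mult_def by simp
    also have "\<dots> = sum ?F {a, b}" using False ab by (simp add: F)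
    also have "\<dots> \<le> (\<Sum>\<mu>\<in>eigenvalues E. ?F \<mu>)" by (rule sum_mono2) (use mem fin in auto)
    finally show ?thesis .
  qed
  have "filter_mset (\<lambda>x. x > c) (\<Sum>\<mu>\<in>I. replicate_mset (eig_mult E \<mu>) \<mu>)
      = (\<Sum>\<mu>\<in>I. filter_mset (\<lambda>x. x > c) (replicate_mset (eig_mult E \<mu>) \<mu>))" if "finite I" for I
    using that by (induction I rule: finite_induct) auto
  then have "size (filter_mset (\<lambda>x. x > c) (\<Sum>\<mu>\<in>eigenvalues E. replicate_mset (eig_mult E \<mu>) \<mu>))
      = (\<Sum>\<mu>\<in>eigenvalues E. ?F \<mu>)"
    using fin by (simp add: size_multiset_sum)
  then show ?thesis unfolding second_eigenvalue_def spectrum_desc_def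
    using second_entry_greater two by metis
qed

text \<open>The plane contains a nonzero vector orthogonal to a top eigenvector \<open>p\<close>, so the Rayleigh
  quotient also exceeds \<open>c\<close> on the orthogonal complement of \<open>p\<close>.\<close>

lemma plane_rayleigh_le_second_eigenvalue:
  assumes E: "simple_graph E"
    and xy: "x \<noteq> 0" "y \<noteq> 0" "x \<bullet> y = 0" "x \<bullet> (adj_matrix E *v y) = d"
    and pos: "\<And>s t :: real. s \<noteq> 0 \<or> t \<noteq> 0 \<Longrightarrow>
      (s *\<^sub>R x + t *\<^sub>R y) \<bullet> (adj_matrix E *v (s *\<^sub>R x + t *\<^sub>R y))
      > c * ((s *\<^sub>R x + t *\<^sub>R y) \<bullet> (s *\<^sub>R x + t *\<^sub>R y))"
  shows "second_eigenvalue E > c"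
proof -
  let ?A = "adj_matrix E"
  have T: "transpose ?A = ?A"
    using transpose_adj_on[OF E, of UNIV] by (simp add: adj_on_UNIV)
  obtain p a where p: "norm p = 1" "?A *v p = a *\<^sub>R p" "\<And>y. y \<bullet> (?A *v y) \<le> a * (y \<bullet> y)"
    by (rule rayleigh_maximum[OF T subspace_UNIV _ _ xy(1)]) auto
  define W where "W = {z. p \<bullet> z = 0}"
  have W: "subspace W" unfolding W_def by (rule subspace_hyperplane)
  have inv: "?A *v z \<in> W" if "z \<in> W" for z
    using that sym_dot[OF T, of p z] p(2) by (simp add: W_def)
  obtain s t where st: "s \<noteq> 0 \<or> t \<noteq> 0" and zW: "s *\<^sub>R x + t *\<^sub>R y \<in> W"
  proof (cases "p \<bullet> x = 0")
    case True
    show ?thesis by (rule that[of 1 0]) (use True in \<open>auto simp: W_def\<close>)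
  next
    case False
    show ?thesis
      by (rule that[of "- (p \<bullet> y)" "p \<bullet> x"]) (use False in \<open>auto simp: W_def inner_diff_right inner_add_right\<close>)
  qed
  let ?z = "s *\<^sub>R x + t *\<^sub>R y"
  have zz: "?z \<bullet> ?z = s\<^sup>2 * (x \<bullet> x) + t\<^sup>2 * (y \<bullet> y)"
    using xy(3) by (simp add: inner_add_left inner_add_right inner_commute power2_eq_square)
  have "?z \<bullet> ?z > 0"
    unfolding zz using st xy(1,2)
    by (metis add_nonneg_pos add_pos_nonneg inner_ge_zero inner_gt_zero_iff mult_nonneg_nonneg
        mult_pos_pos zero_le_power2 zero_less_power2)
  then have zn: "?z \<noteq> 0" by auto
  obtain q b where q: "q \<in> W" "norm q = 1" "?A *v q = b *\<^sub>R q"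
    "\<And>y. y \<in> W \<Longrightarrow> y \<bullet> (?A *v y) \<le> b * (y \<bullet> y)"
    by (rule rayleigh_maximum[OF T W inv zW zn]) auto
  have 1: "c * (?z \<bullet> ?z) < b * (?z \<bullet> ?z)" using pos[OF st] q(4)[OF zW] by linarith
  have 2: "c * (?z \<bullet> ?z) < a * (?z \<bullet> ?z)" using pos[OF st] p(3)[of ?z] by linarith
  show ?thesis
    by (rule second_eigenvalue_greater[OF E p(2) q(3)])
      (use 1 2 \<open>?z \<bullet> ?z > 0\<close> q p in \<open>auto simp: W_def\<close>)
qed

section \<open>Restriction to vertex sets and lower bounds for the second eigenvalue\<close>

definition restrict_vec :: "'v::finite set \<Rightarrow> real^'v \<Rightarrow> real^'v" where
  "restrict_vec X x = (\<chi> v. if v \<in> X then x $ v else 0)"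

lemma restrict_vec_nth [simp]: "restrict_vec X x $ v = (if v \<in> X then x $ v else 0)"
  by (simp add: restrict_vec_def)

lemma restrict_vec_inner: "restrict_vec X x \<bullet> y = x \<bullet> restrict_vec X y"
  by (auto simp: inner_vec_def intro!: sum.cong)

lemma restrict_vec_restrict_vec [simp]: "restrict_vec X (restrict_vec Y x) = restrict_vec (X \<inter> Y) x"
  by (auto simp: vec_eq_iff)

lemma restrict_vec_inner_self: "restrict_vec X x \<bullet> restrict_vec X x = (\<Sum>v\<in>X. (x $ v)\<^sup>2)"
proof -
  have "restrict_vec X x \<bullet> restrict_vec X x = (\<Sum>v\<in>UNIV. if v \<in> X then (x $ v)\<^sup>2 else 0)"
    by (auto simp: inner_vec_def power2_eq_square intro!: sum.cong)
  then show ?thesis by (simp add: sum.If_cases)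
qed

lemma inner_self_eq_sum: "x \<bullet> x = (\<Sum>v\<in>UNIV. (x $ v)\<^sup>2)" for x :: "real^'v"
  by (simp add: inner_vec_def power2_eq_square)

lemma restrict_vec_inner_le: "restrict_vec X x \<bullet> restrict_vec X x \<le> x \<bullet> x"
  unfolding restrict_vec_inner_self inner_self_eq_sum[of x] by (rule sum_mono2) auto

lemma adj_on_restrict_vec:
  assumes "X \<subseteq> Y"
  shows "adj_on E X *v x = restrict_vec X (adj_on E Y *v restrict_vec X x)"
  using assms
  by (auto simp: vec_eq_iff adj_on_nth sum.If_cases Int_def intro!: sum.cong)

lemma adj_on_quadratic:
  assumes "X \<subseteq> Y"
  shows "x \<bullet> (adj_on E X *v x) = restrict_vec X x \<bullet> (adj_on E Y *v restrict_vec X x)"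
  unfolding adj_on_restrict_vec[OF assms] restrict_vec_inner ..

lemma rayleigh_le_mono:
  assumes "rayleigh_le E Y c" "X \<subseteq> Y" "c \<ge> 0"
  shows "rayleigh_le E X c"
  unfolding rayleigh_le_def
proof
  fix x
  have "x \<bullet> (adj_on E X *v x) \<le> c * (restrict_vec X x \<bullet> restrict_vec X x)"
    using assms by (simp add: adj_on_quadratic rayleigh_le_def)
  also have "\<dots> \<le> c * (x \<bullet> x)" by (rule mult_left_mono[OF restrict_vec_inner_le assms(3)])
  finally show "x \<bullet> (adj_on E X *v x) \<le> c * (x \<bullet> x)" .
qed

text \<open>Vectors supported on \<open>X\<close> and on \<open>Y\<close> are orthogonal, and also
  orthogonal for the quadratic form. On the plane spanned by two witnesses the form is therefore
  diagonal and exceeds \<lambda>_2 everywhere, which the plane lemma forbids.\<close>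

lemma rayleigh_le_sets_adjacent:
  assumes E: "simple_graph E" and nn: "second_eigenvalue E \<ge> 0"
    and XY: "\<And>x y. x \<in> X \<Longrightarrow> y \<in> Y \<Longrightarrow> x \<noteq> y \<and> \<not> E x y"
    and nX: "\<not> rayleigh_le E X (second_eigenvalue E)" and nY: "\<not> rayleigh_le E Y (second_eigenvalue E)"
  shows False
proof -
  define c where "c = second_eigenvalue E"
  let ?A = "adj_matrix E"
  have T: "transpose ?A = ?A"
    using transpose_adj_on[OF E, of UNIV] by (simp add: adj_on_UNIV)
  \<comment> \<open>A violating vector may be replaced by its restriction to \<open>Z\<close>: the
    form keeps its value, and since \<open>c \<ge> 0\<close> the right-hand side does not
    grow.\<close>
  have wit: "\<exists>z. restrict_vec Z z = z \<and> z \<noteq> 0 \<and> z \<bullet> (?A *v z) > c * (z \<bullet> z)" if "\<not> rayleigh_le E Z c" for Z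
  proof -
    obtain w where w: "w \<bullet> (adj_on E Z *v w) > c * (w \<bullet> w)" using \<open>\<not> rayleigh_le E Z c\<close> by (auto simp: rayleigh_le_def not_le)
    have "c * (restrict_vec Z w \<bullet> restrict_vec Z w) \<le> c * (w \<bullet> w)"
      using restrict_vec_inner_le[of Z w] nn by (simp add: c_def mult_left_mono)
    then have *: "restrict_vec Z w \<bullet> (?A *v restrict_vec Z w) > c * (restrict_vec Z w \<bullet> restrict_vec Z w)"
      using w adj_on_quadratic[of Z UNIV w E] by (simp add: adj_on_UNIV)
    then have "restrict_vec Z w \<noteq> 0" by auto
    with * show ?thesis by (intro exI[of _ "restrict_vec Z w"]) simp
  qed
  obtain x where x: "restrict_vec X x = x" "x \<noteq> 0" "x \<bullet> (?A *v x) > c * (x \<bullet> x)"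
    using wit nX by (auto simp: c_def)
  obtain y where y: "restrict_vec Y y = y" "y \<noteq> 0" "y \<bullet> (?A *v y) > c * (y \<bullet> y)"
    using wit nY by (auto simp: c_def)
  have sx: "x $ v = 0" if "v \<notin> X" for v using x(1) that by (metis restrict_vec_nth)
  have sy: "y $ v = 0" if "v \<notin> Y" for v using y(1) that by (metis restrict_vec_nth)
  have xy: "x \<bullet> y = 0"
    unfolding inner_vec_def by (rule sum.neutral) (use XY sx sy in force)
  have xAy: "x \<bullet> (?A *v y) = 0"
    unfolding inner_vec_def adj_on_UNIV[symmetric] adj_on_nth
    by (rule sum.neutral) (use XY sx sy in \<open>force intro!: sum.neutral\<close>)
  then have yAx: "y \<bullet> (?A *v x) = 0"
    using sym_dot[OF T, of y x] by (simp add: inner_commute)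
  have "second_eigenvalue E > c"
  proof (rule plane_rayleigh_le_second_eigenvalue[OF E x(2) y(2) xy refl])
    fix s t :: real
    assume st: "s \<noteq> 0 \<or> t \<noteq> 0"
    have "(s *\<^sub>R x + t *\<^sub>R y) \<bullet> (?A *v (s *\<^sub>R x + t *\<^sub>R y))
        = s\<^sup>2 * (x \<bullet> (?A *v x)) + t\<^sup>2 * (y \<bullet> (?A *v y))"
      by (simp add: matrix_vector_right_distrib matrix_vector_mult_scaleR inner_add_left
          inner_add_right xAy yAx algebra_simps power2_eq_square)
    moreover have "c * ((s *\<^sub>R x + t *\<^sub>R y) \<bullet> (s *\<^sub>R x + t *\<^sub>R y))
        = s\<^sup>2 * (c * (x \<bullet> x)) + t\<^sup>2 * (c * (y \<bullet> y))"
      using xy by (simp add: inner_add_left inner_add_right inner_commute algebra_simps power2_eq_square)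
    moreover have "s\<^sup>2 * (c * (x \<bullet> x)) + t\<^sup>2 * (c * (y \<bullet> y))
        < s\<^sup>2 * (x \<bullet> (?A *v x)) + t\<^sup>2 * (y \<bullet> (?A *v y))"
    proof (cases "s = 0")
      case True
      then show ?thesis using st y(3) by simp
    next
      case False
      then show ?thesis using x(3) y(3) by (intro add_less_le_mono mult_strict_left_mono mult_left_mono) auto
    qed
    ultimately show "(s *\<^sub>R x + t *\<^sub>R y) \<bullet> (?A *v (s *\<^sub>R x + t *\<^sub>R y))
        > c * ((s *\<^sub>R x + t *\<^sub>R y) \<bullet> (s *\<^sub>R x + t *\<^sub>R y))" by linarith
  qed
  then show False by (simp add: c_def)
qed

text \<open>On the plane of two coordinate vectors the form is \<open>2 * s * t\<close> or
  \<open>0\<close>, hence at least \<open>- (s\<^sup>2 + t\<^sup>2)\<close>. The plane lemma wants a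
  strict inequality, so every \<open>c < - 1\<close> is treated instead of \<open>- 1\<close>
  itself.\<close>

lemma second_eigenvalue_ge_minus_one:
  fixes E :: "'v::finite \<Rightarrow> 'v \<Rightarrow> bool"
  assumes E: "simple_graph E" and uv: "u \<noteq> (v :: 'v)"
  shows "second_eigenvalue E \<ge> - 1"
proof (rule dense_le)
  fix c :: real assume c: "c < - 1"
  let ?A = "adj_matrix E"
  let ?x = "axis u 1 :: real^'v" and ?y = "axis v 1 :: real^'v"
  have nth: "axis a 1 \<bullet> (?A *v axis b 1) = (if E a b then 1 else 0)" for a b :: 'v
    by (simp add: inner_axis' matrix_vector_mult_basis column_def adj_matrix_def)
  have irr: "\<not> E a a" for a using E by (auto simp: simple_graph_def irreflp_def)
  have sym: "E v u \<longleftrightarrow> E u v" using E by (auto simp: simple_graph_def symp_def)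
  have "second_eigenvalue E > c"
  proof (rule plane_rayleigh_le_second_eigenvalue[OF E, of ?x ?y, OF _ _ _ refl])
    show "?x \<noteq> 0" "?y \<noteq> 0" by (simp_all add: axis_eq_0_iff)
    show xy: "?x \<bullet> ?y = 0" using uv by (simp add: inner_axis_axis)
    fix s t :: real
    assume st: "s \<noteq> 0 \<or> t \<noteq> 0"
    define e :: real where "e = (if E u v then 1 else 0)"
    have 1: "(s *\<^sub>R ?x + t *\<^sub>R ?y) \<bullet> (?A *v (s *\<^sub>R ?x + t *\<^sub>R ?y)) = 2 * s * t * e"
      by (simp add: matrix_vector_right_distrib matrix_vector_mult_scaleR inner_add_left
          inner_add_right nth irr sym e_def algebra_simps)
    have 2: "(s *\<^sub>R ?x + t *\<^sub>R ?y) \<bullet> (s *\<^sub>R ?x + t *\<^sub>R ?y) = s\<^sup>2 + t\<^sup>2"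
      using xy by (simp add: inner_add_left inner_add_right inner_commute inner_axis_axis power2_eq_square)
    have "s\<^sup>2 + t\<^sup>2 > 0" using st by (simp add: sum_power2_gt_zero_iff)
    then have "c * (s\<^sup>2 + t\<^sup>2) < - 1 * (s\<^sup>2 + t\<^sup>2)" using c by (intro mult_strict_right_mono)
    also have "\<dots> \<le> 2 * s * t * e"
    proof -
      have "0 \<le> (s + t)\<^sup>2" by simp
      then show ?thesis unfolding e_def power2_sum
        using zero_le_power2[of s] zero_le_power2[of t] by (simp split: if_split)
    qed
    finally show "(s *\<^sub>R ?x + t *\<^sub>R ?y) \<bullet> (?A *v (s *\<^sub>R ?x + t *\<^sub>R ?y))
        > c * ((s *\<^sub>R ?x + t *\<^sub>R ?y) \<bullet> (s *\<^sub>R ?x + t *\<^sub>R ?y))" unfolding 1 2 .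
  qed
  then show "c \<le> second_eigenvalue E" by simp
qed

section \<open>From Rayleigh quotients to the operator norm\<close>

definition abs_vec :: "real^'v \<Rightarrow> real^'v" where
  "abs_vec x = (\<chi> v. \<bar>x $ v\<bar>)"

lemma abs_vec_nth [simp]: "abs_vec x $ v = \<bar>x $ v\<bar>"
  by (simp add: abs_vec_def)

lemma abs_vec_inner_self: "abs_vec x \<bullet> abs_vec x = x \<bullet> x"
  by (simp add: inner_vec_def)

lemma adj_on_abs_vec: "\<bar>x \<bullet> (adj_on E X *v x)\<bar> \<le> abs_vec x \<bullet> (adj_on E X *v abs_vec x)"
proof -
  have "\<bar>x \<bullet> (adj_on E X *v x)\<bar> \<le> (\<Sum>v\<in>UNIV. \<bar>x $ v * (adj_on E X *v x) $ v\<bar>)"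
    unfolding inner_vec_def inner_real_def by (rule sum_abs)
  also have "\<dots> \<le> (\<Sum>v\<in>UNIV. \<bar>x $ v\<bar> * (adj_on E X *v abs_vec x) $ v)"
    by (intro sum_mono) (auto simp: abs_mult adj_on_nth intro!: mult_left_mono sum_abs)
  finally show ?thesis by (simp add: inner_vec_def)
qed

text \<open>Since the matrix entries are nonnegative, passing to absolute values of the coordinates
  can only raise the form; so an upper bound on the form also controls how negative it gets.\<close>

lemma rayleigh_le_abs:
  assumes "rayleigh_le E X c"
  shows "\<bar>x \<bullet> (adj_on E X *v x)\<bar> \<le> c * (x \<bullet> x)"
proof -
  have "\<bar>x \<bullet> (adj_on E X *v x)\<bar> \<le> abs_vec x \<bullet> (adj_on E X *v abs_vec x)" by (rule adj_on_abs_vec)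
  also have "\<dots> \<le> c * (abs_vec x \<bullet> abs_vec x)" using assms by (simp add: rayleigh_le_def)
  finally show ?thesis by (simp only: abs_vec_inner_self)
qed

lemma rayleigh_le_nonneg:
  fixes E :: "'v::finite \<Rightarrow> 'v \<Rightarrow> bool"
  assumes "rayleigh_le E X c"
  shows "c \<ge> 0"
  using rayleigh_le_abs[OF assms, of "axis undefined 1"] by (simp add: inner_axis_axis)

text \<open>Polarisation: \<open>4 * (y \<bullet> (?B *v z))\<close> is the difference of the form
  at \<open>y + z\<close> and \<open>y - z\<close>, and the parallelogram law adds up the two
  bounds.\<close>

lemma rayleigh_le_norm_le:
  assumes E: "simple_graph E" and rayleigh_le: "rayleigh_le E X c"
  shows "norm (adj_on E X *v z) \<le> c * norm z"
proof (cases "adj_on E X *v z = 0")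
  case True
  then show ?thesis using rayleigh_le_nonneg[OF rayleigh_le] by simp
next
  case False
  let ?B = "adj_on E X"
  define N n0 where "N = norm (?B *v z)" and "n0 = norm z"
  have N: "N > 0" using False by (simp add: N_def)
  have n0: "n0 > 0" using False by (auto simp: n0_def)
  \<comment> \<open>The image of \<open>z\<close> rescaled to the length of \<open>z\<close>: then
    \<open>y \<bullet> (?B *v z)\<close> is the product of the two norms, and both squares in the
    parallelogram law are equal.\<close>
  define y where "y = (n0 / N) *\<^sub>R (?B *v z)"
  have ny: "norm y = n0" using N n0 by (simp add: y_def N_def)
  have sym: "z \<bullet> (?B *v y) = y \<bullet> (?B *v z)"
    using sym_dot[OF transpose_adj_on[OF E, of X], of z y] by (simp add: inner_commute)
  have "4 * (y \<bullet> (?B *v z)) = (y + z) \<bullet> (?B *v (y + z)) - (y - z) \<bullet> (?B *v (y - z))"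
    using sym by (simp add: matrix_vector_right_distrib matrix_vector_mult_diff_distrib
        inner_add_left inner_add_right inner_diff_left inner_diff_right)
  also have "\<dots> \<le> c * ((y + z) \<bullet> (y + z)) + c * ((y - z) \<bullet> (y - z))"
    using rayleigh_le_abs[OF rayleigh_le, of "y + z"] rayleigh_le_abs[OF rayleigh_le, of "y - z"] by linarith
  also have "\<dots> = 2 * c * (y \<bullet> y + z \<bullet> z)"
    by (simp add: inner_add_left inner_add_right inner_diff_left inner_diff_right
        inner_commute algebra_simps)
  also have "\<dots> = 4 * c * n0\<^sup>2" using ny by (simp add: n0_def dot_square_norm)
  finally have "y \<bullet> (?B *v z) \<le> c * n0\<^sup>2" by simp
  moreover have "y \<bullet> (?B *v z) = n0 * N"
    using N unfolding y_def by (simp add: dot_square_norm N_def[symmetric] power2_eq_square)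
  ultimately have "n0 * N \<le> n0 * (c * n0)" by (simp add: power2_eq_square algebra_simps)
  then show ?thesis using n0 by (simp add: N_def n0_def)
qed

section \<open>Powers, traces and the cost of deleting vertices\<close>

definition adj_power :: "('v::finite \<Rightarrow> 'v \<Rightarrow> bool) \<Rightarrow> 'v set \<Rightarrow> nat \<Rightarrow> real^'v \<Rightarrow> real^'v" where
  "adj_power E X k = ((\<lambda>y. adj_on E X *v y) ^^ k)"

lemma adj_power_0 [simp]: "adj_power E X 0 x = x" by (simp add: adj_power_def)

lemma adj_power_Suc: "adj_power E X (Suc k) x = adj_on E X *v adj_power E X k x" by (simp add: adj_power_def)

lemma adj_power_Suc': "adj_power E X (Suc k) x = adj_power E X k (adj_on E X *v x)"
  by (simp add: adj_power_def funpow_swap1)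

lemma adj_power_add: "adj_power E X (j + k) x = adj_power E X j (adj_power E X k x)"
  by (simp add: adj_power_def funpow_add)

lemma adj_power_inner:
  assumes "simple_graph E"
  shows "adj_power E X k x \<bullet> y = x \<bullet> adj_power E X k y"
proof (induction k arbitrary: x y)
  case (Suc k)
  have "adj_power E X (Suc k) x \<bullet> y = adj_power E X k x \<bullet> (adj_on E X *v y)"
    unfolding adj_power_Suc by (rule sym_dot[OF transpose_adj_on[OF assms]])
  then show ?case by (simp add: Suc adj_power_Suc')
qed simp

lemma adj_power_norm_le:
  assumes "simple_graph E" "rayleigh_le E X c"
  shows "norm (adj_power E X k x) \<le> c ^ k * norm x"
proof (induction k)
  case (Suc k)
  have "norm (adj_power E X (Suc k) x) \<le> c * norm (adj_power E X k x)"
    unfolding adj_power_Suc by (rule rayleigh_le_norm_le[OF assms])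
  also have "\<dots> \<le> c * (c ^ k * norm x)" by (rule mult_left_mono[OF Suc rayleigh_le_nonneg[OF assms(2)]])
  finally show ?case by (simp add: mult.assoc)
qed simp

lemma adj_power_eigenvector:
  assumes "adj_on E X *v x = c *\<^sub>R x"
  shows "adj_power E X k x = c ^ k *\<^sub>R x"
  by (induction k) (simp_all add: adj_power_Suc matrix_vector_mult_scaleR assms)

lemma bessel_inequality:
  fixes x :: "'a::euclidean_space"
  assumes "finite B" "pairwise orthogonal B" "\<And>u. u \<in> B \<Longrightarrow> norm u = 1"
  shows "(\<Sum>u\<in>B. (x \<bullet> u)\<^sup>2) \<le> x \<bullet> x"
proof -
  define p where "p = (\<Sum>u\<in>B. (x \<bullet> u) *\<^sub>R u)"
  have up: "u \<bullet> p = x \<bullet> u" if "u \<in> B" for u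
  proof -
    have "u \<bullet> p = (\<Sum>w\<in>B. if w = u then x \<bullet> u else 0)"
      unfolding p_def inner_sum_right using that assms(2,3)
      by (intro sum.cong) (auto simp: pairwise_def orthogonal_def dot_square_norm)
    then show ?thesis using that assms(1) by simp
  qed
  have "p \<bullet> p = (\<Sum>u\<in>B. (x \<bullet> u) * (u \<bullet> p))"
    by (subst (1) p_def) (simp add: inner_sum_left)
  then have pp: "p \<bullet> p = (\<Sum>u\<in>B. (x \<bullet> u)\<^sup>2)" by (simp add: up power2_eq_square)
  have xp: "x \<bullet> p = (\<Sum>u\<in>B. (x \<bullet> u)\<^sup>2)"
    by (simp add: p_def inner_sum_right power2_eq_square)
  have "0 \<le> (x - p) \<bullet> (x - p)" by simp
  then show ?thesis
    using pp xp by (simp add: inner_diff_left inner_diff_right inner_commute)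
qed

text \<open>A form of the statement that the trace of the \<open>2 * s\<close>-th power is at least
  the contribution of one eigenspace. An eigenvector \<open>u\<close> pairs with the
  \<open>s\<close>-th image of the unit vector at \<open>v\<close> to \<open>c ^ s * u $ v\<close>;
  summing the squares over \<open>v\<close> first gives the left side, summing over the orthonormal
  basis first allows Bessel's inequality.\<close>

lemma trace_bound:
  fixes E :: "'v::finite \<Rightarrow> 'v \<Rightarrow> bool"
  assumes E: "simple_graph E" and K: "subspace K"
    and eig: "\<And>x. x \<in> K \<Longrightarrow> adj_on E X *v x = c *\<^sub>R x" and supp: "\<And>x. x \<in> K \<Longrightarrow> restrict_vec X x = x"
  shows "real (dim K) * c ^ (2 * s) \<le> (\<Sum>v\<in>X. (norm (adj_power E X s (axis v 1)))\<^sup>2)"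
proof -
  obtain B where B: "B \<subseteq> K" "pairwise orthogonal B" "\<And>u. u \<in> B \<Longrightarrow> norm u = 1"
    "independent B" "card B = dim K"
    using orthonormal_basis_subspace[OF K] by metis
  have fin: "finite B" using B(4) independent_imp_finite by blast
  have "real (dim K) * c ^ (2 * s) = (\<Sum>u\<in>B. c ^ (2 * s) * (u \<bullet> u))"
    using B(3,5) by (simp add: dot_square_norm)
  also have "\<dots> = (\<Sum>u\<in>B. \<Sum>v\<in>X. (adj_power E X s (axis v 1) \<bullet> u)\<^sup>2)"
  proof (rule sum.cong[OF refl])
    fix u assume u: "u \<in> B"
    then have uK: "u \<in> K" using B(1) by auto
    have "adj_power E X s (axis v 1) \<bullet> u = c ^ s * u $ v" for v
      unfolding adj_power_inner[OF E] adj_power_eigenvector[OF eig[OF uK]] by (simp add: inner_axis')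
    then have "(\<Sum>v\<in>X. (adj_power E X s (axis v 1) \<bullet> u)\<^sup>2) = c ^ (2 * s) * (\<Sum>v\<in>X. (u $ v)\<^sup>2)"
      by (simp add: power_mult_distrib sum_distrib_left power_mult mult.commute[of 2])
    then show "c ^ (2 * s) * (u \<bullet> u) = (\<Sum>v\<in>X. (adj_power E X s (axis v 1) \<bullet> u)\<^sup>2)"
      using restrict_vec_inner_self[of X u] supp[OF uK] by simp
  qed
  also have "\<dots> = (\<Sum>v\<in>X. \<Sum>u\<in>B. (adj_power E X s (axis v 1) \<bullet> u)\<^sup>2)" by (rule sum.swap)
  also have "\<dots> \<le> (\<Sum>v\<in>X. (norm (adj_power E X s (axis v 1)))\<^sup>2)"
    by (intro sum_mono order_trans[OF bessel_inequality[OF fin B(2,3)]]) (simp_all add: dot_square_norm)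
  finally show ?thesis .
qed

text \<open>Each vertex of \<open>S\<close> imposes one linear condition, so deleting it costs at
  most one dimension of the eigenspace.\<close>

lemma dim_vanishing:
  fixes K :: "(real^'v) set"
  assumes K: "subspace K"
  shows "dim K \<le> card S + dim {x\<in>K. \<forall>v\<in>S. x $ v = 0}"
proof -
  let ?T = "{x::real^'v. \<forall>v\<in>S. x $ v = 0}"
  have T: "subspace ?T" by (auto simp: subspace_def)
  have "?T = {x. \<forall>i. i \<notin> - S \<longrightarrow> x $ i = 0}" by auto
  then have dT: "dim ?T = card (- S)" using dim_substandard_cart[of "- S", where 'a=real] by (simp add: dim_vec_eq)
  have "dim {x + y |x y. x \<in> K \<and> y \<in> ?T} + dim (K \<inter> ?T) = dim K + dim ?T"
    by (rule dim_sums_Int[OF K T])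
  moreover have "dim {x + y |x y. x \<in> K \<and> y \<in> ?T} \<le> CARD('v)"
    using dim_subset_UNIV[of "{x + y |x y. x \<in> K \<and> y \<in> ?T}"] by simp
  moreover have "card S + card (- S) = CARD('v)"
    by (metis card_Un_disjoint Compl_partition Compl_disjoint finite)
  moreover have "K \<inter> ?T = {x\<in>K. \<forall>v\<in>S. x $ v = 0}" by auto
  ultimately show ?thesis using dT by simp
qed

section \<open>Balls and the vertices with a bad ball\<close>

primrec nbhd :: "('v \<Rightarrow> 'v \<Rightarrow> bool) \<Rightarrow> nat \<Rightarrow> 'v \<Rightarrow> 'v set" where
  "nbhd E 0 v = {v}"
| "nbhd E (Suc R) v = nbhd E R v \<union> {w. \<exists>u\<in>nbhd E R v. E u w}"

lemma nbhd_self [simp]: "v \<in> nbhd E R v"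
  by (induction R) auto

lemma nbhd_mono: "R \<le> S \<Longrightarrow> nbhd E R v \<subseteq> nbhd E S v"
  by (induction S) (auto simp: le_Suc_eq)

lemma nbhd_trans: "u \<in> nbhd E R v \<Longrightarrow> w \<in> nbhd E S u \<Longrightarrow> w \<in> nbhd E (R + S) v"
  by (induction S arbitrary: w) auto

lemma nbhd_sym:
  assumes "symp E" "u \<in> nbhd E R v"
  shows "v \<in> nbhd E R u"
  using assms(2)
proof (induction R arbitrary: u)
  case (Suc R)
  show ?case
  proof (cases "u \<in> nbhd E R v")
    case True
    then show ?thesis using Suc.IH nbhd_mono[of R "Suc R" E u] by auto
  next
    case False
    then obtain w where w: "w \<in> nbhd E R v" "E w u" using Suc.prems by auto
    then have "w \<in> nbhd E 1 u" using assms(1) by (auto dest: sympD)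
    then show ?thesis using nbhd_trans[of w E 1 u v R] Suc.IH[OF w(1)] by simp
  qed
qed simp

text \<open>The definition extends a ball at its boundary; this opens it at its centre, which is the
  form needed to count it by the degree of the centre.\<close>

lemma nbhd_Suc_subset: "nbhd E (Suc R) v \<subseteq> insert v (\<Union>u\<in>{u. E v u}. nbhd E R u)"
proof (induction R)
  case (Suc R)
  show ?case
  proof
    fix w assume "w \<in> nbhd E (Suc (Suc R)) v"
    then consider "w \<in> nbhd E (Suc R) v" | u where "u \<in> nbhd E (Suc R) v" "E u w" by auto
    then show "w \<in> insert v (\<Union>u\<in>{u. E v u}. nbhd E (Suc R) u)"
    proof cases
      case 1
      then show ?thesis using Suc by auto
    next
      case 2
      then have "u = v \<or> (\<exists>x. E v x \<and> u \<in> nbhd E R x)" using Suc by auto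
      then show ?thesis using 2(2) nbhd_self[of w E "Suc R"] by auto
    qed
  qed
qed auto

lemma card_nbhd_le:
  fixes E :: "'v::finite \<Rightarrow> 'v \<Rightarrow> bool"
  assumes deg: "\<And>v. real (card {w. E v w}) \<le> d" and d: "d \<ge> 2"
  shows "real (card (nbhd E R v)) \<le> d ^ (R + 1)"
proof -
  \<comment> \<open>Subtracting 1 strengthens the induction hypothesis:
    \<open>1 + d * (d ^ (R + 1) - 1) \<le> d ^ (R + 2) - 1\<close> because
    \<open>d \<ge> 2\<close>.\<close>
  have "real (card (nbhd E R v)) \<le> d ^ (R + 1) - 1"
  proof (induction R arbitrary: v)
    case (Suc R)
    have p: "d ^ (R + 1) \<ge> 1" by (rule one_le_power) (use d in simp)
    have "card (nbhd E (Suc R) v) \<le> card (insert v (\<Union>u\<in>{u. E v u}. nbhd E R u))"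
      by (rule card_mono[OF finite nbhd_Suc_subset])
    also have "\<dots> \<le> 1 + card (\<Union>u\<in>{u. E v u}. nbhd E R u)"
      by (simp add: card_insert_le_m1 card_insert_if)
    also have "\<dots> \<le> 1 + (\<Sum>u\<in>{u. E v u}. card (nbhd E R u))"
      using card_UN_le[of "{u. E v u}" "nbhd E R"] by simp
    finally have "real (card (nbhd E (Suc R) v)) \<le> 1 + (\<Sum>u\<in>{u. E v u}. real (card (nbhd E R u)))"
      by (metis of_nat_1 of_nat_add of_nat_le_iff of_nat_sum)
    also have "\<dots> \<le> 1 + (\<Sum>u\<in>{u. E v u}. d ^ (R + 1) - 1)" by (intro add_left_mono sum_mono Suc)
    also have "\<dots> = 1 + real (card {u. E v u}) * (d ^ (R + 1) - 1)" by simp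
    also have "\<dots> \<le> 1 + d * (d ^ (R + 1) - 1)" using deg p by (intro add_left_mono mult_right_mono) auto
    also have "\<dots> \<le> d ^ (Suc R + 1) - 1" using d by (simp add: algebra_simps)
    finally show ?case .
  qed (use d in auto)
  then show ?thesis by linarith
qed

lemma card_bad_vertices_le:
  fixes E :: "'v::finite \<Rightarrow> 'v \<Rightarrow> bool"
  assumes E: "simple_graph E" and nn: "second_eigenvalue E \<ge> 0"
    and deg: "\<And>v. real (card {w. E v w}) \<le> d" and d: "d \<ge> 2"
  shows "real (card {v. \<not> rayleigh_le E (nbhd E R v) (second_eigenvalue E)}) \<le> d ^ (2 * R + 2)"
proof (cases "{v. \<not> rayleigh_le E (nbhd E R v) (second_eigenvalue E)} = {}")
  case True
  then show ?thesis using d by simp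
next
  case False
  then obtain u where u: "\<not> rayleigh_le E (nbhd E R u) (second_eigenvalue E)" by auto
  have sym: "symp E" using E by (simp add: simple_graph_def)
  have "{v. \<not> rayleigh_le E (nbhd E R v) (second_eigenvalue E)} \<subseteq> nbhd E (2 * R + 1) u"
  proof clarify
    fix v assume "\<not> rayleigh_le E (nbhd E R v) (second_eigenvalue E)"
    then obtain x y where "x \<in> nbhd E R u" "y \<in> nbhd E R v" "x = y \<or> E x y"
      using rayleigh_le_sets_adjacent[OF E nn _ u] by metis
    then have "y \<in> nbhd E (Suc R) u" "v \<in> nbhd E R y" using nbhd_sym[OF sym] by auto
    then show "v \<in> nbhd E (2 * R + 1) u"
      using nbhd_trans[of y E "Suc R" u v R] by (simp add: mult_2)
  qed
  then have "card {v. \<not> rayleigh_le E (nbhd E R v) (second_eigenvalue E)} \<le> card (nbhd E (2 * R + 1) u)"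
    by (intro card_mono) auto
  also have "real \<dots> \<le> d ^ (2 * R + 2)" using card_nbhd_le[of E d "2 * R + 1" u] deg d by simp
  finally show ?thesis by simp
qed

section \<open>Locality and the counting of walks\<close>

lemma adj_power_axis_support:
  assumes "simple_graph E" "w \<notin> nbhd E k v"
  shows "adj_power E X k (axis v 1) $ w = 0"
  using assms(2)
proof (induction k arbitrary: w)
  case (Suc k)
  have "adj_power E X k (axis v 1) $ u = 0" if "E w u" for u
  proof (rule Suc.IH)
    show "u \<notin> nbhd E k v" using Suc.prems that assms(1) by (auto simp: simple_graph_def dest: sympD)
  qed
  then show ?case by (auto simp: adj_power_Suc adj_on_nth intro!: sum.neutral)
qed (simp add: axis_def)

text \<open>In at most \<open>s\<close> steps from \<open>v\<close> nothing outside the ball is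
  reached, so a Rayleigh bound on the ball controls these powers for all of
  \<open>X\<close>.\<close>

lemma adj_power_axis_local:
  assumes E: "simple_graph E" and "k \<le> s"
  shows "adj_power E X k (axis v 1) = adj_power E (X \<inter> nbhd E s v) k (axis v 1)"
  using assms(2)
proof (induction k)
  case (Suc k)
  define z where "z = adj_power E (X \<inter> nbhd E s v) k (axis v 1)"
  have zz: "adj_power E X k (axis v 1) = z" using Suc by (simp add: z_def)
  have supp: "z $ u = 0" if "u \<notin> nbhd E k v" for u
    unfolding z_def by (rule adj_power_axis_support[OF E that])
  have sub: "nbhd E k v \<subseteq> nbhd E s v" "nbhd E (Suc k) v \<subseteq> nbhd E s v" using Suc.prems by (auto intro!: nbhd_mono simp del: nbhd.simps)
  have "adj_on E X *v z = adj_on E (X \<inter> nbhd E s v) *v z"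
  proof (rule vec_eq_iff[THEN iffD2], rule allI)
    fix w
    show "(adj_on E X *v z) $ w = (adj_on E (X \<inter> nbhd E s v) *v z) $ w"
    proof (cases "w \<in> nbhd E s v")
      case True
      then show ?thesis unfolding adj_on_nth
        using supp sub by (auto intro!: sum.mono_neutral_right)
    next
      case False
      have "z $ u = 0" if "E w u" for u
      proof (rule supp, rule notI)
        assume "u \<in> nbhd E k v"
        then have "w \<in> nbhd E (Suc k) v" using that E by (auto simp: simple_graph_def dest: sympD)
        then show False using sub False by auto
      qed
      then show ?thesis unfolding adj_on_nth by (auto intro!: sum.neutral)
    qed
  qed
  then show ?case using zz by (simp add: adj_power_Suc z_def)
qed simp

text \<open>The list omits the start \<open>v\<close>, which is also not asked to lie in
  \<open>X\<close>; a walk of length \<open>k\<close> is thus a list of \<open>k\<close> vertices,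
  and the walks split disjointly by their head.\<close>

primrec walks :: "('v \<Rightarrow> 'v \<Rightarrow> bool) \<Rightarrow> 'v set \<Rightarrow> nat \<Rightarrow> 'v \<Rightarrow> 'v list set" where
  "walks E X 0 v = {[]}"
| "walks E X (Suc k) v = (\<Union>u\<in>{u\<in>X. E v u}. (#) u ` walks E X k u)"

lemma finite_walks [simp]: "finite (walks (E :: 'v::finite \<Rightarrow> _) X k v)"
  by (induction k arbitrary: v) auto

lemma walks_Diff: "walks E (X - S) k v = {xs\<in>walks E X k v. set xs \<inter> S = {}}"
  by (induction k arbitrary: v) auto

lemma walks_mono: "X \<subseteq> Y \<Longrightarrow> walks E X k v \<subseteq> walks E Y k v"
  by (induction k arbitrary: v) fastforce+

lemma walks_set: "xs \<in> walks E X k v \<Longrightarrow> set xs \<subseteq> X"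
  by (induction k arbitrary: v xs) fastforce+

text \<open>The predicate \<open>P\<close> lets one recurrence serve both counts: walks with a given
  end point and walks with few vertices.\<close>

lemma card_walks_Suc:
  fixes E :: "'v::finite \<Rightarrow> 'v \<Rightarrow> bool"
  shows "card {xs\<in>walks E X (Suc k) v. P xs} = (\<Sum>u\<in>{u\<in>X. E v u}. card {xs\<in>walks E X k u. P (u # xs)})"
proof -
  have 1: "{xs\<in>walks E X (Suc k) v. P xs} = (\<Union>u\<in>{u\<in>X. E v u}. (#) u ` {xs\<in>walks E X k u. P (u # xs)})"
    by auto
  have 2: "card (\<Union>u\<in>{u\<in>X. E v u}. (#) u ` {xs\<in>walks E X k u. P (u # xs)})
      = (\<Sum>u\<in>{u\<in>X. E v u}. card ((#) u ` {xs\<in>walks E X k u. P (u # xs)}))"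
    by (rule card_UN_disjoint) auto
  show ?thesis unfolding 1 2 by (simp add: card_image)
qed

lemma adj_power_eq_card_walks:
  fixes E :: "'v::finite \<Rightarrow> 'v \<Rightarrow> bool"
  assumes "v \<in> X"
  shows "adj_power E X k (axis w 1) $ v = real (card {xs\<in>walks E X k v. last (v # xs) = w})"
  using assms
proof (induction k arbitrary: v)
  case 0
  then show ?case by (auto simp: axis_def)
next
  case (Suc k)
  have "adj_power E X (Suc k) (axis w 1) $ v = (\<Sum>u\<in>{u\<in>X. E v u}. real (card {xs\<in>walks E X k u. last (u # xs) = w}))"
    using Suc by (simp add: adj_power_Suc adj_on_nth)
  also have "\<dots> = real (card {xs\<in>walks E X (Suc k) v. last (v # xs) = w})"
    unfolding card_walks_Suc of_nat_sum by (simp del: last.simps add: last_ConsR)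
  finally show ?case .
qed

definition closed_walks :: "('v \<Rightarrow> 'v \<Rightarrow> bool) \<Rightarrow> 'v set \<Rightarrow> nat \<Rightarrow> 'v \<Rightarrow> 'v list set" where
  "closed_walks E X k v = {xs\<in>walks E X k v. last (v # xs) = v}"

lemma finite_closed_walks [simp]: "finite (closed_walks (E :: 'v::finite \<Rightarrow> _) X k v)"
  by (simp add: closed_walks_def)

lemma norm_adj_power_axis:
  fixes E :: "'v::finite \<Rightarrow> 'v \<Rightarrow> bool"
  assumes "simple_graph E" "v \<in> X"
  shows "(norm (adj_power E X s (axis v 1)))\<^sup>2 = real (card (closed_walks E X (2 * s) v))"
proof -
  have "(norm (adj_power E X s (axis v 1)))\<^sup>2 = adj_power E X s (axis v 1) \<bullet> adj_power E X s (axis v 1)"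
    by (simp add: dot_square_norm)
  also have "\<dots> = adj_power E X (2 * s) (axis v 1) \<bullet> axis v 1"
    by (simp add: adj_power_inner[OF assms(1), symmetric] adj_power_add mult_2)
  also have "\<dots> = adj_power E X (2 * s) (axis v 1) $ v" by (simp add: inner_axis)
  finally show ?thesis using assms(2) by (simp add: adj_power_eq_card_walks closed_walks_def)
qed

text \<open>A closed walk of length \<open>2 * s\<close> never gets farther than \<open>s\<close>
  from its start. The proof compares cardinalities: both are the squared norm of a vector obtained
  in only \<open>s\<close> steps, where locality is already known, and one set contains the
  other.\<close>

lemma closed_walks_local:
  fixes E :: "'v::finite \<Rightarrow> 'v \<Rightarrow> bool"
  assumes E: "simple_graph E" and v: "v \<in> X"
  shows "closed_walks E X (2 * s) v = closed_walks E (X \<inter> nbhd E s v) (2 * s) v"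
proof -
  have "card (closed_walks E X (2 * s) v) = card (closed_walks E (X \<inter> nbhd E s v) (2 * s) v)"
    using norm_adj_power_axis[OF E v, of s] norm_adj_power_axis[OF E, of v "X \<inter> nbhd E s v" s] v
      adj_power_axis_local[OF E order_refl, of X s v] by simp
  moreover have "closed_walks E (X \<inter> nbhd E s v) (2 * s) v \<subseteq> closed_walks E X (2 * s) v"
    using walks_mono[of "X \<inter> nbhd E s v" X E "2 * s" v] by (auto simp: closed_walks_def)
  ultimately show ?thesis by (metis card_subset_eq finite_closed_walks)
qed

section \<open>Walks with few vertices and random deletion\<close>

text \<open>The image of the unit vector at \<open>u\<close> has the degree of \<open>u\<close> as
  its squared norm. This makes the walk counts depend on the eigenvalue instead of the maximum
  degree.\<close>

lemma rayleigh_le_degree_le: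
  fixes E :: "'v::finite \<Rightarrow> 'v \<Rightarrow> bool"
  assumes E: "simple_graph E" and rayleigh_le: "rayleigh_le E Y c" and u: "u \<in> Y"
  shows "real (card {w\<in>Y. E u w}) \<le> c\<^sup>2"
proof -
  have sym: "E w u \<longleftrightarrow> E u w" for w using E by (auto simp: simple_graph_def symp_def)
  have "(norm (adj_on E Y *v axis u 1))\<^sup>2 = (\<Sum>w\<in>UNIV. if w \<in> {w\<in>Y. E u w} then 1 else 0)"
    unfolding dot_square_norm[symmetric] inner_self_eq_sum
    by (rule sum.cong) (use u in \<open>auto simp: adj_on_def matrix_vector_mult_basis column_def sym\<close>)
  also have "\<dots> = real (card {w\<in>Y. E u w})" by (simp add: sum.If_cases)
  finally have "real (card {w\<in>Y. E u w}) = (norm (adj_on E Y *v axis u 1))\<^sup>2" by simp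
  also have "\<dots> \<le> c\<^sup>2" using rayleigh_le_norm_le[OF E rayleigh_le, of "axis u 1"] by (intro power_mono) simp_all
  finally show ?thesis .
qed

text \<open>A step of a walk leads to one of at most \<open>m\<close> known vertices or, at a cost \<open>\<theta>\<close>, to one of at
  most \<open>D\<close> new ones.\<close>

lemma card_walks_few_vertices:
  fixes E :: "'v::finite \<Rightarrow> 'v \<Rightarrow> bool"
  assumes deg: "\<And>u. u \<in> Y \<Longrightarrow> real (card {w\<in>Y. E u w}) \<le> D"
    and \<theta>: "0 < \<theta>" "\<theta> \<le> 1" and v: "v \<in> Y" and T: "card T \<le> m"
  shows "real (card {xs\<in>walks E Y k v. card (T \<union> set xs) \<le> m}) * \<theta> ^ (m - card T) \<le> (real m + \<theta> * D) ^ k"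
  using v T
proof (induction k arbitrary: v T)
  case 0
  have "real (card {xs\<in>walks E Y 0 v. card (T \<union> set xs) \<le> m}) \<le> real (card {[] :: 'v list})"
    unfolding of_nat_le_iff by (rule card_mono) auto
  then have "real (card {xs\<in>walks E Y 0 v. card (T \<union> set xs) \<le> m}) * \<theta> ^ (m - card T) \<le> 1 * 1"
    using \<theta> by (intro mult_mono power_le_one) auto
  then show ?case by simp
next
  case (Suc k)
  let ?Q = "(real m + \<theta> * D) ^ k"
  let ?N = "{u\<in>Y. E v u}"
  let ?C = "\<lambda>u. real (card {xs\<in>walks E Y k u. card (T \<union> set (u # xs)) \<le> m})"
  have D: "D \<ge> 0" using deg[OF Suc.prems(1)] by (meson of_nat_0_le_iff order_trans)
  have Q: "?Q \<ge> 0" using D \<theta> by simp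
  have step: "?C u * \<theta> ^ (m - card T) \<le> (if u \<in> T then ?Q else \<theta> * ?Q)" if u: "u \<in> ?N" for u
  proof (cases "u \<in> T")
    case True
    then have "T \<union> set (u # xs) = T \<union> set xs" for xs by auto
    then show ?thesis using Suc.IH[of u T] u True Suc.prems by simp
  next
    case False
    have eq: "T \<union> set (u # xs) = insert u T \<union> set xs" for xs by auto
    have ci: "card (insert u T) = card T + 1" using False by simp
    show ?thesis
    \<comment> \<open>A vertex outside \<open>T\<close> uses up one unit of the budget
      \<open>m - card T\<close>, which pays for the factor \<theta>. Once the budget is exhausted,
      no walk entering a new vertex qualifies.\<close>
    proof (cases "card T + 1 \<le> m")
      case True
      have "?C u * \<theta> ^ (m - card (insert u T)) \<le> ?Q"
        unfolding eq using Suc.IH[of u "insert u T"] u True ci by simp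
      moreover have "m - card T = Suc (m - card (insert u T))" using True ci by simp
      ultimately have "?C u * \<theta> ^ (m - card T) \<le> \<theta> * ?Q"
        using \<theta> by (simp add: mult.left_commute)
      then show ?thesis using False by simp
    next
      case True2: False
      have "card (T \<union> set (u # xs)) > m" for xs
      proof -
        have "card (insert u T) \<le> card (T \<union> set (u # xs))" by (rule card_mono) auto
        then show ?thesis using True2 ci by linarith
      qed
      then have e: "{xs\<in>walks E Y k u. card (T \<union> set (u # xs)) \<le> m} = {}" by (auto simp: not_le)
      show ?thesis unfolding e using False Q \<theta> by simp
    qed
  qed
  have "real (card {xs\<in>walks E Y (Suc k) v. card (T \<union> set xs) \<le> m}) * \<theta> ^ (m - card T)
      = (\<Sum>u\<in>?N. ?C u * \<theta> ^ (m - card T))"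
    unfolding card_walks_Suc of_nat_sum sum_distrib_right ..
  also have "\<dots> \<le> (\<Sum>u\<in>?N. if u \<in> T then ?Q else \<theta> * ?Q)" by (rule sum_mono[OF step])
  also have "\<dots> = real (card (?N \<inter> T)) * ?Q + real (card (?N \<inter> - T)) * (\<theta> * ?Q)"
    by (simp add: sum.If_cases)
  also have "\<dots> \<le> real m * ?Q + D * (\<theta> * ?Q)"
  proof (intro add_mono mult_right_mono)
    have "card (?N \<inter> T) \<le> card T" by (rule card_mono) auto
    then show "real (card (?N \<inter> T)) \<le> real m" using Suc.prems by simp
    have "card (?N \<inter> - T) \<le> card ?N" by (rule card_mono) auto
    then show "real (card (?N \<inter> - T)) \<le> D" using deg[OF Suc.prems(1)] by linarith
  qed (use Q \<theta> in auto)
  also have "\<dots> = (real m + \<theta> * D) ^ Suc k" by (simp add: algebra_simps)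
  finally show ?case .
qed

text \<open>The weight is the probability that a deletion at rate \<open>p\<close> spares the walk.
  Walks with more than \<open>m\<close> vertices have weight at most \<open>(1 - p) ^ m\<close> and
  number at most \<open>c ^ (2 * s)\<close>; the rest have weight at most 1 and are counted
  separately.\<close>

lemma closed_walks_weight_le:
  fixes E :: "'v::finite \<Rightarrow> 'v \<Rightarrow> bool"
  assumes E: "simple_graph E" and rayleigh_le: "rayleigh_le E Y c" and v: "v \<in> Y"
    and p: "0 \<le> p" "p \<le> 1" and m: "1 \<le> m" "real m \<le> c\<^sup>2"
  shows "(\<Sum>xs\<in>closed_walks E Y (2 * s) v. (1 - p) ^ card (insert v (set xs)))
    \<le> c ^ (2 * s) * (1 - p) ^ m + (2 * real m) ^ (2 * s) * (c\<^sup>2 / real m) ^ m"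
proof -
  let ?W = "closed_walks E Y (2 * s) v"
  let ?F = "{xs\<in>walks E Y (2 * s) v. card ({v} \<union> set xs) \<le> m}"
  \<comment> \<open>Balances the two kinds of steps: known vertices contribute \<open>m\<close> and
    new ones \<open>\<theta> * c\<^sup>2 = m\<close>, so each step costs \<open>2 * m\<close>. The
    hypothesis \<open>m \<le> c\<^sup>2\<close> gives \<theta> \<le> 1.\<close>
  define \<theta> where "\<theta> = real m / c\<^sup>2"
  have c2: "c\<^sup>2 > 0" using m by linarith
  have \<theta>: "0 < \<theta>" "\<theta> \<le> 1" using m c2 by (auto simp: \<theta>_def)
  have "(\<Sum>xs\<in>?W. (1 - p) ^ card (insert v (set xs)))
      \<le> (\<Sum>xs\<in>?W. (1 - p) ^ m + (if card (insert v (set xs)) \<le> m then 1 else 0))"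
  proof (rule sum_mono)
    fix xs
    show "(1 - p) ^ card (insert v (set xs)) \<le> (1 - p) ^ m + (if card (insert v (set xs)) \<le> m then 1 else 0)"
    proof (cases "card (insert v (set xs)) \<le> m")
      case True
      have "(1 - p) ^ card (insert v (set xs)) \<le> 1" "(1 - p) ^ m \<ge> 0"
        using p by (auto intro: power_le_one)
      then show ?thesis using True by simp
    next
      case False
      then have "(1 - p) ^ card (insert v (set xs)) \<le> (1 - p) ^ m"
        using p by (intro power_decreasing) auto
      then show ?thesis using False by simp
    qed
  qed
  also have "\<dots> = real (card ?W) * (1 - p) ^ m + real (card (?W \<inter> {xs. card (insert v (set xs)) \<le> m}))"
    by (simp add: sum.distrib sum.If_cases)
  also have "\<dots> \<le> c ^ (2 * s) * (1 - p) ^ m + (2 * real m) ^ (2 * s) * (c\<^sup>2 / real m) ^ m"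
  proof (intro add_mono mult_right_mono)
    have "norm (adj_power E Y s (axis v 1)) \<le> c ^ s" using adj_power_norm_le[OF E rayleigh_le, of s "axis v 1"] by simp
    then have "(norm (adj_power E Y s (axis v 1)))\<^sup>2 \<le> (c ^ s)\<^sup>2" by (intro power_mono) auto
    then show "real (card ?W) \<le> c ^ (2 * s)"
      by (simp add: norm_adj_power_axis[OF E v] power_mult[symmetric] mult.commute)
    have "card (?W \<inter> {xs. card (insert v (set xs)) \<le> m}) \<le> card ?F"
      by (rule card_mono) (auto simp: closed_walks_def)
    then have "real (card (?W \<inter> {xs. card (insert v (set xs)) \<le> m})) * \<theta> ^ m \<le> real (card ?F) * \<theta> ^ (m - card {v})"
      using \<theta> by (intro mult_mono power_decreasing) auto
    also have "\<dots> \<le> (real m + \<theta> * c\<^sup>2) ^ (2 * s)"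
      by (rule card_walks_few_vertices) (use rayleigh_le_degree_le[OF E rayleigh_le] \<theta> v m in auto)
    also have "\<dots> = (2 * real m) ^ (2 * s)" using c2 by (simp add: \<theta>_def)
    finally have "real (card (?W \<inter> {xs. card (insert v (set xs)) \<le> m})) \<le> (2 * real m) ^ (2 * s) / \<theta> ^ m"
      using \<theta> by (simp add: pos_le_divide_eq)
    also have "\<dots> = (2 * real m) ^ (2 * s) * (c\<^sup>2 / real m) ^ m"
      unfolding \<theta>_def by (simp add: power_divide)
    finally show "real (card (?W \<inter> {xs. card (insert v (set xs)) \<le> m})) \<le> (2 * real m) ^ (2 * s) * (c\<^sup>2 / real m) ^ m" .
  qed (use p in auto)
  finally show ?thesis .
qed

text \<open>The right-hand side is the expectation of the left-hand side for a random subset \<open>S\<close> of \<open>T\<close>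
  that contains each element independently with probability \<open>p\<close>.\<close>

lemma exists_hitting_set:
  fixes c p :: real and B :: "'i \<Rightarrow> 'a set"
  assumes "finite T" "finite I" "0 \<le> p" "p \<le> 1"
  shows "\<exists>S\<subseteq>T. c * real (card S) + real (card {i\<in>I. B i \<inter> S = {}})
    \<le> c * p * real (card T) + (\<Sum>i\<in>I. (1 - p) ^ card (B i \<inter> T))"
  using assms(1,2)
proof (induction T arbitrary: I rule: finite_induct)
  case (insert t T)
  let ?J = "{i\<in>I. t \<notin> B i}"
  let ?g = "\<lambda>i. (1 - p) ^ card (B i \<inter> T)"
  let ?R = "c * p * real (card (insert t T)) + (\<Sum>i\<in>I. (1 - p) ^ card (B i \<inter> insert t T))"
  let ?a = "c + c * p * real (card T) + (\<Sum>i\<in>?J. ?g i)"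
  let ?b = "c * p * real (card T) + (\<Sum>i\<in>I. ?g i)"
  \<comment> \<open>Conditional expectations: \<open>?a\<close> bounds the cost once
    \<open>t\<close> is chosen, when only the sets avoiding \<open>t\<close> can remain unhit, and
    \<open>?b\<close> the cost once it is not. The claimed bound is their average with weights
    \<open>p\<close> and \<open>1 - p\<close>.\<close>
  obtain S1 where S1: "S1 \<subseteq> T" "c * real (card S1) + real (card {i\<in>?J. B i \<inter> S1 = {}})
    \<le> c * p * real (card T) + (\<Sum>i\<in>?J. ?g i)" using insert.IH[of ?J] insert.prems by auto
  obtain S2 where S2: "S2 \<subseteq> T" "c * real (card S2) + real (card {i\<in>I. B i \<inter> S2 = {}}) \<le> ?b"
    using insert.IH[of I] insert.prems by auto
  have split: "(\<Sum>i\<in>I. h i) = (\<Sum>i\<in>?J. h i) + (\<Sum>i\<in>{i\<in>I. t \<in> B i}. h i)" for h :: "'i \<Rightarrow> real"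
    by (subst sum.union_disjoint[symmetric]) (use insert.prems in \<open>auto intro!: sum.cong\<close>)
  have "(1 - p) ^ card (B i \<inter> insert t T) = (1 - p) * ?g i" if "t \<in> B i" for i
  proof -
    have "B i \<inter> insert t T = insert t (B i \<inter> T)" using that by auto
    then show ?thesis using insert.hyps by simp
  qed
  moreover have "(1 - p) ^ card (B i \<inter> insert t T) = ?g i" if "t \<notin> B i" for i
    using that by simp
  ultimately have "(\<Sum>i\<in>I. (1 - p) ^ card (B i \<inter> insert t T))
      = (\<Sum>i\<in>?J. ?g i) + (1 - p) * (\<Sum>i\<in>{i\<in>I. t \<in> B i}. ?g i)"
    unfolding split[of "\<lambda>i. (1 - p) ^ card (B i \<inter> insert t T)"] sum_distrib_left
    by (intro arg_cong2[of _ _ _ _ "(+)"] sum.cong) auto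
  moreover have "real (card (insert t T)) = real (card T) + 1" using insert.hyps by simp
  ultimately have "?R = p * ?a + (1 - p) * ?b"
    unfolding split[of ?g] by (simp add: algebra_simps)
  moreover have "a \<le> r \<or> b \<le> r" if "r = p * a + (1 - p) * b" for a b r :: real
  proof -
    have "p * min a b + (1 - p) * min a b \<le> p * a + (1 - p) * b"
      using assms(3,4) by (intro add_mono mult_left_mono) auto
    then show ?thesis using that by (simp add: algebra_simps min_def split: if_splits)
  qed
  ultimately have "?a \<le> ?R \<or> ?b \<le> ?R" by blast
  then show ?case
  proof
    assume a: "?a \<le> ?R"
    have "t \<notin> S1" "finite S1" using S1(1) insert.hyps finite_subset by auto
    moreover have "{i\<in>I. B i \<inter> insert t S1 = {}} = {i\<in>?J. B i \<inter> S1 = {}}" by auto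
    ultimately have "c * real (card (insert t S1)) + real (card {i\<in>I. B i \<inter> insert t S1 = {}}) \<le> ?a"
      using S1(2) by (simp add: algebra_simps)
    then show ?thesis using a S1(1) by (intro exI[of _ "insert t S1"]) auto
  next
    assume "?b \<le> ?R"
    then show ?thesis using S2 by (intro exI[of _ S2]) auto
  qed
qed (auto intro!: exI[of _ "{}"])

section \<open>Multiplicity after a random deletion\<close>

lemma subspace_eigenspace: "subspace {x. (B :: real^'v^'v) *v x = c *\<^sub>R x}"
  by (auto simp: subspace_def matrix_vector_right_distrib scaleR_right_distrib matrix_vector_mult_scaleR)

lemma eigenvector_supported:
  assumes "adj_matrix E *v x = c *\<^sub>R x" "\<And>v. v \<notin> X \<Longrightarrow> x $ v = 0"
  shows "adj_on E X *v x = c *\<^sub>R x" "restrict_vec X x = x"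
proof -
  show r: "restrict_vec X x = x" using assms(2) by (auto simp: vec_eq_iff)
  have "adj_on E X *v x = restrict_vec X (c *\<^sub>R x)"
    using adj_on_restrict_vec[of X UNIV E x] r assms(1) by (simp add: adj_on_UNIV)
  also have "\<dots> = c *\<^sub>R x" using assms(2) by (auto simp: vec_eq_iff)
  finally show "adj_on E X *v x = c *\<^sub>R x" .
qed

text \<open>Read the eigenvector equation at a coordinate of largest modulus. Only neighbours in the
  support are counted, so that an eigenvector living on one component also bounds the size of that
  component.\<close>

lemma eigenvalue_le_degree:
  fixes E :: "'v::finite \<Rightarrow> 'v \<Rightarrow> bool"
  assumes deg: "\<And>v. real (card {w. E v w}) \<le> d" and x: "adj_matrix E *v x = c *\<^sub>R x" "x $ u \<noteq> 0"
  shows "\<exists>v. x $ v \<noteq> 0 \<and> \<bar>c\<bar> \<le> real (card {w. E v w \<and> x $ w \<noteq> 0}) \<and> \<bar>c\<bar> \<le> d"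
proof -
  obtain v where v: "\<And>w. \<bar>x $ w\<bar> \<le> \<bar>x $ v\<bar>"
  proof -
    have "Max (range (\<lambda>w. \<bar>x $ w\<bar>)) \<in> range (\<lambda>w. \<bar>x $ w\<bar>)" by (rule Max_in) auto
    then obtain v where "Max (range (\<lambda>w. \<bar>x $ w\<bar>)) = \<bar>x $ v\<bar>" unfolding image_iff by blast
    then show ?thesis using that[of v] Max_ge[of "range (\<lambda>w. \<bar>x $ w\<bar>)"] by auto
  qed
  have pos: "\<bar>x $ v\<bar> > 0" using v[of u] x(2) by linarith
  have "c * x $ v = (\<Sum>w\<in>{w. E v w}. x $ w)"
    using arg_cong[OF x(1), of "\<lambda>y. y $ v"] adj_on_nth[of E UNIV x v] by (simp add: adj_on_UNIV)
  also have "\<dots> = (\<Sum>w\<in>{w. E v w \<and> x $ w \<noteq> 0}. x $ w)" by (rule sum.mono_neutral_right) auto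
  finally have "\<bar>c\<bar> * \<bar>x $ v\<bar> = \<bar>\<Sum>w\<in>{w. E v w \<and> x $ w \<noteq> 0}. x $ w\<bar>" by (simp flip: abs_mult)
  also have "\<dots> \<le> (\<Sum>w\<in>{w. E v w \<and> x $ w \<noteq> 0}. \<bar>x $ v\<bar>)" by (rule order_trans[OF sum_abs sum_mono[OF v]])
  also have "\<dots> = real (card {w. E v w \<and> x $ w \<noteq> 0}) * \<bar>x $ v\<bar>" by simp
  finally have le: "\<bar>c\<bar> \<le> real (card {w. E v w \<and> x $ w \<noteq> 0})" using pos by simp
  have "card {w. E v w \<and> x $ w \<noteq> 0} \<le> card {w. E v w}" by (rule card_mono) auto
  then show ?thesis using le deg[of v] pos by (intro exI[of _ v]) auto
qed

lemma eig_mult_le_random_deletion: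
  fixes E :: "'v::finite \<Rightarrow> 'v \<Rightarrow> bool"
  assumes E: "simple_graph E" and lam: "lam = second_eigenvalue E" "lam > 0"
    and deg: "\<And>v. real (card {w. E v w}) \<le> d" and d: "d \<ge> 2"
    and p: "0 \<le> p" "p \<le> 1" and m: "1 \<le> m" "real m \<le> lam\<^sup>2"
  shows "real (eig_mult E lam) \<le> d ^ (2 * s + 2)
    + real CARD('v) * (p + (1 - p) ^ m + (2 * real m) ^ (2 * s) * (lam\<^sup>2 / real m) ^ m / lam ^ (2 * s))"
proof -
  define U where "U = {v. \<not> rayleigh_le E (nbhd E s v) lam}"
  define K where "K = {x. adj_matrix E *v x = lam *\<^sub>R x}"
  define W where "W = closed_walks E (- U) (2 * s)"
  define Q where "Q = lam ^ (2 * s) * (1 - p) ^ m + (2 * real m) ^ (2 * s) * (lam\<^sup>2 / real m) ^ m"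
  let ?n = "real CARD('v)"
  let ?c = "lam ^ (2 * s)"
  let ?B = "\<lambda>(v, xs). insert v (set xs)"
  have c0: "?c > 0" using lam by simp
  have Q0: "Q \<ge> 0" using p lam by (simp add: Q_def)
  have K: "subspace K" unfolding K_def by (rule subspace_eigenspace)
  have U: "real (card U) \<le> d ^ (2 * s + 2)"
    unfolding U_def lam(1) by (rule card_bad_vertices_le[OF E _ deg d]) (use lam in simp)
  have weight: "(\<Sum>xs\<in>W v. (1 - p) ^ card (insert v (set xs))) \<le> Q" if v: "v \<in> - U" for v
  proof -
    have "rayleigh_le E (- U \<inter> nbhd E s v) lam"
      by (rule rayleigh_le_mono[of E "nbhd E s v"]) (use v lam in \<open>auto simp: U_def\<close>)
    then show ?thesis unfolding W_def closed_walks_local[OF E v] Q_def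
      by (rule closed_walks_weight_le[OF E]) (use v p m in auto)
  qed
  \<comment> \<open>A deleted vertex costs one dimension, and by the trace bound one dimension is
    worth \<open>lam ^ (2 * s)\<close> closed walks; this is the exchange rate
    \<open>?c\<close>.\<close>
  obtain S where S: "S \<subseteq> - U"
    and le: "?c * real (card S) + real (card {i\<in>Sigma (- U) W. ?B i \<inter> S = {}})
      \<le> ?c * p * real (card (- U)) + (\<Sum>i\<in>Sigma (- U) W. (1 - p) ^ card (?B i \<inter> - U))"
    using exists_hitting_set[of "- U" "Sigma (- U) W" p ?c ?B] p by (auto simp: W_def)
  define X where "X = - U - S"
  have "{i\<in>Sigma (- U) W. ?B i \<inter> S = {}} = Sigma X (closed_walks E X (2 * s))"
    by (auto simp: X_def W_def closed_walks_def walks_Diff)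
  then have cardI: "real (card {i\<in>Sigma (- U) W. ?B i \<inter> S = {}})
      = (\<Sum>v\<in>X. real (card (closed_walks E X (2 * s) v)))"
    by (simp add: card_SigmaI)
  have "(\<Sum>i\<in>Sigma (- U) W. (1 - p) ^ card (?B i \<inter> - U))
      = (\<Sum>i\<in>Sigma (- U) W. (1 - p) ^ card (?B i))"
  proof (rule sum.cong[OF refl])
    fix i assume "i \<in> Sigma (- U) W"
    then have "?B i \<subseteq> - U" using walks_set[of "snd i" E "- U" "2 * s" "fst i"]
      by (auto simp: W_def closed_walks_def)
    then show "(1 - p) ^ card (?B i \<inter> - U) = (1 - p) ^ card (?B i)" by (simp add: Int_absorb2)
  qed
  also have "\<dots> = (\<Sum>v\<in>- U. \<Sum>xs\<in>W v. (1 - p) ^ card (insert v (set xs)))"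
    by (subst sum.Sigma) (auto simp: W_def split_beta)
  also have "\<dots> \<le> (\<Sum>v\<in>- U. Q)" by (rule sum_mono[OF weight])
  also have "\<dots> = real (card (- U)) * Q" by simp
  finally have sumQ: "(\<Sum>i\<in>Sigma (- U) W. (1 - p) ^ card (?B i \<inter> - U)) \<le> real (card (- U)) * Q" .
  define K' where "K' = {x\<in>K. \<forall>v\<in>U \<union> S. x $ v = 0}"
  have K': "subspace K'" using K by (auto simp: K'_def subspace_def)
  have "real (dim K') * ?c \<le> (\<Sum>v\<in>X. (norm (adj_power E X s (axis v 1)))\<^sup>2)"
    by (rule trace_bound[OF E K']) (auto simp: K'_def K_def X_def intro!: eigenvector_supported)
  also have "\<dots> = (\<Sum>v\<in>X. real (card (closed_walks E X (2 * s) v)))"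
    by (rule sum.cong) (simp_all add: norm_adj_power_axis[OF E])
  finally have "?c * (real (card S) + real (dim K')) \<le> ?c * p * real (card (- U)) + real (card (- U)) * Q"
    using le sumQ cardI by (simp add: algebra_simps)
  also have "\<dots> \<le> ?c * p * ?n + ?n * Q"
    using c0 p Q0 card_mono[of UNIV "- U"] by (intro add_mono mult_left_mono mult_right_mono) auto
  also have "\<dots> = ?c * (?n * (p + (1 - p) ^ m + (2 * real m) ^ (2 * s) * (lam\<^sup>2 / real m) ^ m / ?c))"
    using c0 lam by (simp add: Q_def field_simps)
  finally have SK: "real (card S) + real (dim K') \<le> ?n * (p + (1 - p) ^ m + (2 * real m) ^ (2 * s) * (lam\<^sup>2 / real m) ^ m / ?c)"
    using c0 by (simp only: mult_le_cancel_left_pos)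
  have "eig_mult E lam \<le> card (U \<union> S) + dim K'"
    unfolding eig_mult_def K_def[symmetric] K'_def by (rule dim_vanishing[OF K])
  also have "card (U \<union> S) \<le> card U + card S" by (rule card_Un_le)
  finally show ?thesis using U SK by linarith
qed

section \<open>Choice of the parameters and the first bound\<close>

lemma log2_ge_of_power_le:
  assumes "2 ^ k \<le> x"
  shows "real k \<le> log 2 x"
proof -
  have "(0 :: real) < 2 ^ k" by simp
  then have "x > 0" using assms by linarith
  then show ?thesis using assms by (simp add: le_log_iff powr_realpow)
qed

text \<open>\<beta> is the maximum in the theorem and \<open>3 * \<beta>\<close> the deletion
  probability. The assumption \<beta> < 1/5 excludes only trivial cases, and it forces
  \<open>lam\<close> and \<open>L\<close> to be large.\<close>

lemma deletion_parameters:
  fixes lam L \<beta> :: real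
  assumes lam: "lam > 0" and L: "L \<ge> 1" and b: "\<beta> < 1 / 5"
    and b1: "log 2 (lam + 1) / lam \<le> \<beta>" and b2: "(log 2 (1 + L))\<^sup>2 / L \<le> \<beta>"
  obtains s m where "2 * real s + 3 \<le> L" "1 \<le> m" "real m \<le> lam\<^sup>2" "4 / lam \<le> \<beta>"
    "(1 - 3 * \<beta>) ^ m \<le> \<beta>" "(2 * real m) ^ (2 * s) * (lam\<^sup>2 / real m) ^ m / lam ^ (2 * s) \<le> \<beta> / 2"
proof -
  have ln2: "ln 2 \<le> (3 / 4 :: real)" using ln2_le_25_over_36 by simp
  define g where "g = log 2 (lam + 1)"
  define l where "l = log 2 (1 + L)"
  have g1: "g \<le> \<beta> * lam" using b1 lam by (simp add: g_def field_simps)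
  have g5: "5 * g < lam"
  proof -
    have "\<beta> * lam < 1 / 5 * lam" using b lam by (rule mult_strict_right_mono)
    then show ?thesis using g1 by simp
  qed
  \<comment> \<open>Bootstrapping: a lower bound for \<open>lam\<close> gives one for the logarithm,
    which improves the former, from 3 through 10 and 15 to 20. The rule \<open>lk\<close> below does
    the same for \<open>L\<close>.\<close>
  have gk: "5 * real k < lam" if "2 ^ k \<le> lam + 1" for k
    using log2_ge_of_power_le[OF that] g5 by (simp add: g_def)
  have "lam > 3"
  proof (rule ccontr)
    assume "\<not> lam > 3"
    then have l3: "lam \<le> 3" by simp
    have "ln (1 / (lam + 1)) \<le> 1 / (lam + 1) - 1" using lam by (intro ln_le_minus_one) simp
    then have 1: "ln (lam + 1) \<ge> lam / (lam + 1)" using lam by (simp add: ln_div field_simps)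
    have "lam / 4 \<le> lam / (lam + 1)" using lam l3 by (intro divide_left_mono) auto
    also have "\<dots> \<le> g * ln 2" using 1 by (simp add: g_def log_def)
    also have "\<dots> \<le> g * (3 / 4)" using ln2 lam by (intro mult_left_mono) (auto simp: g_def)
    finally show False using g5 lam by simp
  qed
  then have "lam > 10" using gk[of 2] by simp
  then have "lam > 15" using gk[of 3] by simp
  then have lam20: "lam > 20" using gk[of 4] by simp
  have g4: "g \<ge> 4" using log2_ge_of_power_le[of 4 "lam + 1"] lam20 by (simp add: g_def)
  have l2: "l\<^sup>2 \<le> \<beta> * L" using b2 L by (simp add: l_def field_simps)
  have l5: "5 * l\<^sup>2 < L"
  proof -
    have "\<beta> * L < 1 / 5 * L" using b L by (intro mult_strict_right_mono) auto
    then show ?thesis using l2 by simp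
  qed
  have lk: "5 * real (k\<^sup>2) < L" if "2 ^ k \<le> 1 + L" for k
  proof -
    have "real k \<le> l" using log2_ge_of_power_le[OF that] by (simp add: l_def)
    then have "(real k)\<^sup>2 \<le> l\<^sup>2" by (intro power_mono) auto
    then show ?thesis using l5 by simp
  qed
  have "L > 5" using lk[of 1] L by simp
  then have "L > 20" using lk[of 2] by simp
  then have "L > 80" using lk[of 4] by simp
  then have "L > 180" using lk[of 6] by simp
  then have L245: "L > 245" using lk[of 7] by simp
  have l7: "l \<ge> 7" using log2_ge_of_power_le[of 7 "1 + L"] L245 by (simp add: l_def)
  have "7 * l \<le> l * l" using l7 by (intro mult_right_mono) auto
  then have l35: "35 * l < L" using l5 by (simp add: power2_eq_square)
  have b4: "4 / lam \<le> \<beta>" using g1 g4 lam by (simp add: field_simps)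
  have b0: "\<beta> > 0" by (rule less_le_trans[OF _ b4]) (use lam in simp)
  have lnb: "ln (1 / \<beta>) > 0" using b0 b by simp
  \<comment> \<open>\<open>A\<close> and \<open>B\<close> keep \<open>m\<close> below a fraction of
    \<open>lam\<close> and of \<open>L / l\<close>. In each case the hypothesis is used twice: to
    bound \<open>1 / \<beta>\<close> inside the logarithm and to absorb the \<beta> in the
    denominator.\<close>
  have A: "ln (1 / \<beta>) / (3 * \<beta>) \<le> lam / 4"
  proof -
    have "1 / \<beta> \<le> lam + 1"
    proof -
      have "1 \<le> \<beta> * lam" using g1 g4 by simp
      then show ?thesis using b0 by (simp add: field_simps)
    qed
    then have "ln (1 / \<beta>) \<le> ln (lam + 1)" using b0 lam by (intro ln_mono) auto
    also have "\<dots> = g * ln 2" by (simp add: g_def log_def)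
    also have "\<dots> \<le> g * (3 / 4)" using ln2 g4 by (intro mult_left_mono) auto
    also have "\<dots> \<le> \<beta> * lam * (3 / 4)" using g1 by simp
    finally show ?thesis using b0 by (simp add: field_simps)
  qed
  have lb: "1 / (1 + L) \<le> \<beta>"
  proof -
    have "1 * 1 \<le> l * l" using l7 by (intro mult_mono) auto
    then have "1 \<le> \<beta> * L" using l2 by (simp add: power2_eq_square)
    then show ?thesis using b0 L by (simp add: field_simps)
  qed
  have B: "ln (1 / \<beta>) / (3 * \<beta>) \<le> L / (4 * l)"
  proof -
    have "1 / \<beta> \<le> 1 + L" using lb b0 L by (simp add: field_simps)
    then have "ln (1 / \<beta>) \<le> ln (1 + L)" using b0 L by (intro ln_mono) auto
    also have "\<dots> = l * ln 2" by (simp add: l_def log_def)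
    also have "\<dots> \<le> l * (3 / 4)" using ln2 l7 by (intro mult_left_mono) auto
    finally have "ln (1 / \<beta>) * (4 * l) \<le> 3 * l\<^sup>2" using l7 by (simp add: power2_eq_square)
    also have "\<dots> \<le> 3 * (\<beta> * L)" using l2 by simp
    finally show ?thesis using b0 l7 by (simp add: field_simps)
  qed
  \<comment> \<open>The least \<open>m\<close> with
    \<open>exp (- (3 * \<beta> * m)) \<le> \<beta>\<close>.\<close>
  define m where "m = nat \<lceil>ln (1 / \<beta>) / (3 * \<beta>)\<rceil>"
  have mq: "ln (1 / \<beta>) / (3 * \<beta>) \<le> real m" "real m < ln (1 / \<beta>) / (3 * \<beta>) + 1"
    using lnb b0 by (auto simp: m_def) linarith+
  have q0: "ln (1 / \<beta>) / (3 * \<beta>) > 0" using lnb b0 by simp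
  then have m1: "m \<ge> 1" using mq(1) by (cases m) auto
  have ml: "real m \<le> 3 / 10 * lam" using mq(2) A lam20 by linarith
  have "L / (4 * l) \<le> L / 28" using l7 L by (intro divide_left_mono) auto
  then have mL: "real m \<le> 1 + L / (4 * l)" "real m \<le> 1 + L / 28" using mq(2) B by linarith+
  have m2: "real m \<le> lam\<^sup>2"
  proof -
    have "1 * lam \<le> lam * lam" using lam20 by (intro mult_right_mono) auto
    then show ?thesis using ml lam unfolding power2_eq_square by linarith
  qed
  have pm: "(1 - 3 * \<beta>) ^ m \<le> \<beta>"
  proof -
    have "(1 - 3 * \<beta>) ^ m \<le> (exp (- (3 * \<beta>))) ^ m"
      using b exp_ge_add_one_self[of "- (3 * \<beta>)"] by (intro power_mono) auto
    also have "\<dots> = exp (- (3 * \<beta> * real m))" by (simp flip: exp_of_nat_mult add: mult.commute)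
    also have "\<dots> \<le> exp (- ln (1 / \<beta>))" using mq(1) b0 by (simp add: field_simps)
    also have "\<dots> = \<beta>" using b0 by (simp add: ln_div)
    finally show ?thesis .
  qed
  \<comment> \<open>The largest radius with \<open>2 * s + 2 \<le> L - 1\<close>; the spare 1 leaves
    a factor \<open>d\<close> between the number of bad vertices and \<open>n\<close>.\<close>
  define s where "s = nat \<lfloor>(L - 3) / 2\<rfloor>"
  have s: "2 * real s + 3 \<le> L" "L - 5 \<le> 2 * real s"
  proof -
    define z where "z = real_of_int \<lfloor>(L - 3) / 2\<rfloor>"
    have "real s = z" using L245 by (simp add: s_def z_def)
    moreover have "z \<le> (L - 3) / 2" "(L - 3) / 2 < z + 1"
      using floor_correct[of "(L - 3) / 2"] by (simp_all add: z_def)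
    ultimately show "2 * real s + 3 \<le> L" "L - 5 \<le> 2 * real s" by (simp_all add: field_simps)
  qed
  have sm: "m \<le> s" using s(2) mL(2) L245 by linarith
  have "(2 * real m) ^ (2 * s) * (lam\<^sup>2 / real m) ^ m / lam ^ (2 * s)
      = (2 * real m / lam) ^ (2 * s) * (lam\<^sup>2 / real m) ^ m"
    by (simp add: power_divide)
  \<comment> \<open>Of the \<open>2 * s\<close> small factors, \<open>2 * m\<close> turn
    \<open>lam\<^sup>2 / m\<close> into the harmless \<open>4 * m\<close>. The other
    \<open>s - m\<close> pairs each give at most 1/2; as \<open>s\<close> is about
    \<open>L / 2\<close> and \<open>l * m\<close> at most \<open>l + L / 4\<close>, they
    win.\<close>
  also have "2 * s = 2 * (s - m) + 2 * m" using sm by simp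
  also have "(2 * real m / lam) ^ (2 * (s - m) + 2 * m) * (lam\<^sup>2 / real m) ^ m
      = ((2 * real m / lam)\<^sup>2) ^ (s - m) * ((2 * real m / lam)\<^sup>2 * (lam\<^sup>2 / real m)) ^ m"
    by (simp only: power_add power_mult power_mult_distrib mult.assoc)
  also have "(2 * real m / lam)\<^sup>2 * (lam\<^sup>2 / real m) = 4 * real m"
    using lam m1 by (simp add: field_simps power2_eq_square)
  also have "((2 * real m / lam)\<^sup>2) ^ (s - m) * (4 * real m) ^ m \<le> (1 / 2) ^ (s - m) * (1 + L) ^ m"
  proof (intro mult_mono power_mono)
    have "2 * real m / lam \<le> 3 / 5" using ml lam by (simp add: field_simps)
    then have "(2 * real m / lam)\<^sup>2 \<le> (3 / 5)\<^sup>2" using lam by (intro power_mono) auto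
    also have "\<dots> \<le> 1 / 2" by (simp add: power2_eq_square)
    finally show "(2 * real m / lam)\<^sup>2 \<le> 1 / 2" .
    show "4 * real m \<le> 1 + L" using mL(2) L245 by linarith
  qed (use L in auto)
  also have "(1 / 2 :: real) ^ (s - m) = 2 powr (- real (s - m))"
    by (simp add: powr_minus powr_realpow power_divide inverse_eq_divide)
  also have "(1 + L) ^ m = 2 powr (l * real m)"
    using L by (simp add: l_def powr_powr[symmetric] powr_realpow)
  also have "2 powr (- real (s - m)) * 2 powr (l * real m) = 2 powr (l * real m - real (s - m))"
    by (simp flip: powr_add)
  also have "\<dots> \<le> 2 powr (- l - 1)"
  proof (rule powr_mono)
    have "l * real m \<le> l * (1 + L / (4 * l))" using mL(1) l7 by (intro mult_left_mono) auto
    also have "\<dots> = l + L / 4" using l7 by (simp add: field_simps)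
    finally show "l * real m - real (s - m) \<le> - l - 1"
      using s(2) mL(2) sm l35 L245 by (simp add: of_nat_diff)
  qed simp
  also have "\<dots> = 1 / (1 + L) / 2"
    using L by (simp add: powr_diff powr_minus l_def inverse_eq_divide)
  also have "\<dots> \<le> \<beta> / 2" using divide_right_mono[OF lb, of 2] by linarith
  finally have "(2 * real m) ^ (2 * s) * (lam\<^sup>2 / real m) ^ m / lam ^ (2 * s) \<le> \<beta> / 2"
    using sm by (simp only: le_add_diff_inverse2 flip: distrib_left)
  then show ?thesis by (rule that[OF s(1) m1 m2 b4 pm])
qed

lemma eig_mult_le_card: "eig_mult (E :: 'v::finite \<Rightarrow> 'v \<Rightarrow> bool) \<mu> \<le> CARD('v)"
  unfolding eig_mult_def using dim_subset_UNIV[of "{x::real^'v. adj_matrix E *v x = \<mu> *\<^sub>R x}"] by simp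

lemma second_eigenvalue_le_degree:
  fixes E :: "'v::finite \<Rightarrow> 'v \<Rightarrow> bool"
  assumes deg: "\<And>v. real (card {w. E v w}) \<le> d" and "eig_mult E c \<noteq> 0"
  shows "c \<le> d"
proof -
  have "\<not> {x. adj_matrix E *v x = c *\<^sub>R x} \<subseteq> {0}"
    using assms(2) unfolding eig_mult_def dim_eq_0 .
  then obtain x where x: "adj_matrix E *v x = c *\<^sub>R x" "x \<noteq> 0" by auto
  then obtain u where "x $ u \<noteq> 0" by (auto simp: vec_eq_iff)
  then show ?thesis using eigenvalue_le_degree[OF deg x(1)] by fastforce
qed

lemma eig_mult_second_le_max:
  fixes E :: "'v::finite \<Rightarrow> 'v \<Rightarrow> bool"
  assumes E: "simple_graph E" and lam: "lam = second_eigenvalue E" "lam > 0"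
    and deg: "\<And>v. real (card {w. E v w}) \<le> d" and d: "d \<ge> 2" "d \<le> real CARD('v)"
  shows "real (eig_mult E lam) \<le> 5 * real CARD('v)
    * max (log 2 (lam + 1) / lam) ((log 2 (1 + log d (real CARD('v))))\<^sup>2 / log d (real CARD('v)))"
proof -
  define n where "n = real CARD('v)"
  define L where "L = log d n"
  define \<beta> where "\<beta> = max (log 2 (lam + 1) / lam) ((log 2 (1 + L))\<^sup>2 / L)"
  have n: "n > 0" "n \<ge> 2" using d by (auto simp: n_def)
  have L: "L \<ge> 1" unfolding L_def using d n by (simp add: n_def)
  have b0: "\<beta> \<ge> 0" using lam by (simp add: \<beta>_def le_max_iff_disj)
  \<comment> \<open>For \<beta> \<ge> 1/5 the right side is at least \<open>n\<close>. A nonzero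
    multiplicity makes \<open>lam\<close> an eigenvalue, whence \<open>lam \<le> d\<close>.\<close>
  have "real (eig_mult E lam) \<le> 5 * n * \<beta>"
  proof (cases "\<beta> < 1 / 5 \<and> eig_mult E lam \<noteq> 0")
    case False
    then consider "\<beta> \<ge> 1 / 5" | "eig_mult E lam = 0" by linarith
    then show ?thesis
    proof cases
      case 1
      have "real (eig_mult E lam) \<le> n" using eig_mult_le_card[of E lam] by (simp add: n_def)
      also have "\<dots> \<le> n * (5 * \<beta>)" using 1 n by simp
      finally show ?thesis by (simp add: mult_ac)
    qed (use n b0 in simp)
  next
    case True
    have ld: "lam \<le> d" using second_eigenvalue_le_degree[of E d lam, OF deg] True by simp
    obtain s m where sm: "2 * real s + 3 \<le> L" "1 \<le> m" "real m \<le> lam\<^sup>2" "4 / lam \<le> \<beta>"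
      "(1 - 3 * \<beta>) ^ m \<le> \<beta>" "(2 * real m) ^ (2 * s) * (lam\<^sup>2 / real m) ^ m / lam ^ (2 * s) \<le> \<beta> / 2"
    proof (rule deletion_parameters[OF lam(2) L])
      show "\<beta> < 1 / 5" using True by simp
      show "log 2 (lam + 1) / lam \<le> \<beta>" "(log 2 (1 + L))\<^sup>2 / L \<le> \<beta>" by (simp_all add: \<beta>_def)
    qed
    have "d ^ (2 * s + 2) = d powr (2 * real s + 2)"
      using powr_realpow[of d "2 * s + 2"] d by (simp only: of_nat_add of_nat_mult of_nat_numeral)
    also have "\<dots> \<le> d powr (L - 1)" using sm(1) d by (intro powr_mono) auto
    also have "\<dots> = n / d" using d n by (simp add: powr_diff L_def)
    also have "\<dots> \<le> n / lam" using ld lam n by (intro divide_left_mono) auto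
    also have "\<dots> \<le> n * (\<beta> / 4)" using mult_left_mono[OF sm(4), of n] n by simp
    finally have 1: "d ^ (2 * s + 2) \<le> n * (\<beta> / 4)" .
    have "real (eig_mult E lam) \<le> d ^ (2 * s + 2)
      + n * (3 * \<beta> + (1 - 3 * \<beta>) ^ m + (2 * real m) ^ (2 * s) * (lam\<^sup>2 / real m) ^ m / lam ^ (2 * s))"
      unfolding n_def by (rule eig_mult_le_random_deletion[OF E lam deg d(1) _ _ sm(2,3)])
        (use True b0 in auto)
    \<comment> \<open>In units of \<open>n * \<beta>\<close>: 1/4 for bad vertices, 3 for random
      deletion, 1 for walks with many vertices, 1/2 for those with few; in total 4.75.\<close>
    also have "\<dots> \<le> n * (\<beta> / 4) + n * (3 * \<beta> + \<beta> + \<beta> / 2)"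
      using 1 sm(5,6) n by (intro add_mono mult_left_mono) auto
    also have "\<dots> \<le> 5 * n * \<beta>" using n b0 by (simp add: algebra_simps)
    finally show ?thesis .
  qed
  then show ?thesis by (simp add: n_def L_def \<beta>_def)
qed

section \<open>The spectral gap left by deleting a packing\<close>

lemma adj_power_mono_nonneg:
  assumes "Y \<subseteq> Z" "\<And>v. x $ v \<ge> 0"
  shows "0 \<le> adj_power E Y j x $ v \<and> adj_power E Y j x $ v \<le> adj_power E Z j x $ v"
proof (induction j arbitrary: v)
  case (Suc j)
  have le: "0 \<le> adj_power E Y j x $ w" "adj_power E Y j x $ w \<le> adj_power E Z j x $ w" "0 \<le> adj_power E Z j x $ w" for w
    using Suc[of w] by auto
  have "(\<Sum>w\<in>{w\<in>Y. E v w}. adj_power E Y j x $ w) \<le> (\<Sum>w\<in>{w\<in>Y. E v w}. adj_power E Z j x $ w)"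
    by (rule sum_mono) (rule le)
  also have "\<dots> \<le> (\<Sum>w\<in>{w\<in>Z. E v w}. adj_power E Z j x $ w)"
    by (rule sum_mono2) (use assms(1) le in auto)
  finally show ?case
    using assms(1) le by (auto simp: adj_power_Suc adj_on_nth intro!: sum_nonneg)
qed (use assms in auto)

lemma rayleigh_le_of_degree:
  fixes E :: "'v::finite \<Rightarrow> 'v \<Rightarrow> bool"
  assumes E: "simple_graph E" and deg: "\<And>u. u \<in> F \<Longrightarrow> real (card {w\<in>F. E u w}) \<le> d" and d: "d \<ge> 0"
  shows "rayleigh_le E F d"
  unfolding rayleigh_le_def
proof
  fix x :: "real^'v"
  define a :: "'v \<Rightarrow> 'v \<Rightarrow> real" where "a u w = (if u \<in> F \<and> w \<in> F \<and> E u w then 1 else 0)" for u w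
  have sym: "a u w = a w u" for u w using E by (auto simp: a_def simple_graph_def symp_def)
  have "x \<bullet> (adj_on E F *v x) = (\<Sum>u\<in>UNIV. \<Sum>w\<in>UNIV. a u w * (x $ u * x $ w))"
    by (simp add: inner_vec_def matrix_vector_mult_def adj_on_def a_def sum_distrib_left mult_ac)
  also have "\<dots> \<le> (\<Sum>u\<in>UNIV. \<Sum>w\<in>UNIV. a u w * ((x $ u)\<^sup>2 / 2) + a u w * ((x $ w)\<^sup>2 / 2))"
  proof (intro sum_mono)
    fix u w
    have "0 \<le> (x $ u - x $ w)\<^sup>2" by simp
    then have "x $ u * x $ w \<le> (x $ u)\<^sup>2 / 2 + (x $ w)\<^sup>2 / 2" by (simp add: power2_diff)
    then show "a u w * (x $ u * x $ w) \<le> a u w * ((x $ u)\<^sup>2 / 2) + a u w * ((x $ w)\<^sup>2 / 2)"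
      by (simp add: a_def)
  qed
  also have "\<dots> = (\<Sum>u\<in>UNIV. \<Sum>w\<in>UNIV. a u w * ((x $ u)\<^sup>2 / 2)) + (\<Sum>u\<in>UNIV. \<Sum>w\<in>UNIV. a w u * ((x $ w)\<^sup>2 / 2))"
    unfolding sum.distrib by (subst (2) sym) simp
  also have "(\<Sum>u\<in>UNIV. \<Sum>w\<in>UNIV. a w u * ((x $ w)\<^sup>2 / 2)) = (\<Sum>u\<in>UNIV. \<Sum>w\<in>UNIV. a u w * ((x $ u)\<^sup>2 / 2))"
    by (rule sum.swap)
  also have "(\<Sum>u\<in>UNIV. \<Sum>w\<in>UNIV. a u w * ((x $ u)\<^sup>2 / 2)) + (\<Sum>u\<in>UNIV. \<Sum>w\<in>UNIV. a u w * ((x $ u)\<^sup>2 / 2))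
      = (\<Sum>u\<in>UNIV. (\<Sum>w\<in>UNIV. a u w) * (x $ u)\<^sup>2)"
    by (simp add: sum.distrib[symmetric] sum_distrib_right[symmetric])
  also have "\<dots> \<le> (\<Sum>u\<in>UNIV. d * (x $ u)\<^sup>2)"
  proof (intro sum_mono mult_right_mono)
    fix u
    have "(\<Sum>w\<in>UNIV. a u w) = (if u \<in> F then real (card {w\<in>F. E u w}) else 0)"
      by (auto simp: a_def sum.If_cases Int_def)
    then show "(\<Sum>w\<in>UNIV. a u w) \<le> d" using deg d by auto
  qed simp
  also have "\<dots> = d * (x \<bullet> x)" by (simp add: inner_self_eq_sum sum_distrib_left)
  finally show "x \<bullet> (adj_on E F *v x) \<le> d * (x \<bullet> x)" .
qed

text \<open>Taking absolute values of a maximiser does not lower the form, so the result is again a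
  maximiser and hence an eigenvector.\<close>

lemma perron_vector:
  fixes E :: "'v::finite \<Rightarrow> 'v \<Rightarrow> bool"
  assumes E: "simple_graph E" and n: "\<not> rayleigh_le E Y c"
  obtains x \<mu> where "\<mu> > c" "adj_on E Y *v x = \<mu> *\<^sub>R x" "norm x = 1" "\<And>v. x $ v \<ge> 0"
proof -
  let ?B = "adj_on E Y"
  note T = transpose_adj_on[OF E, of Y]
  obtain y where y: "y \<bullet> (?B *v y) > c * (y \<bullet> y)" using n by (auto simp: rayleigh_le_def not_le)
  then have "y \<noteq> 0" by auto
  then obtain z \<mu> where z: "norm z = 1" "?B *v z = \<mu> *\<^sub>R z" and mx: "\<And>y. y \<bullet> (?B *v y) \<le> \<mu> * (y \<bullet> y)"
    using rayleigh_maximum[OF T subspace_UNIV, of y] by auto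
  have "c * (y \<bullet> y) < \<mu> * (y \<bullet> y)" using y mx[of y] by linarith
  then have mu: "\<mu> > c" using \<open>y \<noteq> 0\<close> by simp
  have "\<mu> * (abs_vec z \<bullet> abs_vec z) \<le> abs_vec z \<bullet> (?B *v abs_vec z)"
    using adj_on_abs_vec[of z E Y] z by (simp add: abs_vec_inner_self)
  then have "?B *v abs_vec z = \<mu> *\<^sub>R abs_vec z"
    by (intro maximizer_eigenvector[OF T subspace_UNIV]) (use mx in \<open>auto intro: antisym\<close>)
  moreover have "norm (abs_vec z) = 1" using abs_vec_inner_self[of z] z(1) by (simp add: norm_eq_sqrt_inner)
  ultimately show ?thesis using that mu by simp
qed

lemma power_diff_le:
  fixes a b :: real
  assumes "0 \<le> b" "b \<le> a"
  shows "a ^ Suc k - b ^ Suc k \<le> real (Suc k) * a ^ k * (a - b)"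
proof (induction k)
  case (Suc k)
  have "a ^ Suc (Suc k) - b ^ Suc (Suc k) = a * (a ^ Suc k - b ^ Suc k) + b ^ Suc k * (a - b)"
    by (simp add: algebra_simps)
  also have "\<dots> \<le> a * (real (Suc k) * a ^ k * (a - b)) + a ^ Suc k * (a - b)"
    using assms by (intro add_mono mult_left_mono Suc mult_right_mono power_mono) auto
  also have "\<dots> = real (Suc (Suc k)) * a ^ Suc k * (a - b)" by (simp add: algebra_simps)
  finally show ?case .
qed simp

lemma sum_squares_le_square_sum:
  fixes f :: "'a \<Rightarrow> real"
  assumes "finite A" "\<And>a. a \<in> A \<Longrightarrow> f a \<ge> 0"
  shows "(\<Sum>a\<in>A. (f a)\<^sup>2) \<le> (\<Sum>a\<in>A. f a)\<^sup>2"
  using assms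
proof (induction A rule: finite_induct)
  case (insert a A)
  have "0 \<le> f a * (\<Sum>a\<in>A. f a)" using insert by (auto intro!: mult_nonneg_nonneg sum_nonneg)
  then show ?case using insert by (simp add: power2_sum)
qed simp

text \<open>Let \<open>x\<close> be the Perron vector of \<open>Y\<close>, with eigenvalue \<open>\<mu>\<close> close to \<open>lam\<close>. Applying the operator
  of \<open>Z\<close> at most six times moves the mass of \<open>x\<close> from the vertices of \<open>Y\<close> near \<open>P\<close> into \<open>P\<close>, so this
  mass is small. The remaining vertices have too small degrees to support the eigenvalue \<open>\<mu>\<close>.\<close>

lemma rayleigh_le_gap:
  fixes E :: "'v::finite \<Rightarrow> 'v \<Rightarrow> bool"
  assumes E: "simple_graph E" and lam: "lam \<ge> 1" and YZ: "Y \<subseteq> Z" and Z: "rayleigh_le E Z lam"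
    and P: "Y \<inter> P = {}"
    and near: "\<And>u. u \<in> Y \<Longrightarrow> real (card {w\<in>Y. E u w}) > lam - 1 \<Longrightarrow>
      \<exists>w\<in>P. \<exists>j\<in>{1..6}. adj_power E Z j (axis w 1) $ u \<ge> 1"
  shows "rayleigh_le E Y (lam - 1 / (360 * lam ^ 13))"
proof (rule ccontr)
  assume "\<not> rayleigh_le E Y (lam - 1 / (360 * lam ^ 13))"
  then obtain x \<mu> where mu: "\<mu> > lam - 1 / (360 * lam ^ 13)"
    and x: "adj_on E Y *v x = \<mu> *\<^sub>R x" "norm x = 1" "\<And>v. x $ v \<ge> 0"
    using perron_vector[OF E] by metis
  let ?B = "adj_on E Y"
  define D where "D = lam - \<mu>"
  have l13: "lam ^ 13 \<ge> 1" using lam by simp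
  have "D < 1 / (360 * lam ^ 13)" using mu by (simp add: D_def)
  then have D1: "360 * lam ^ 13 * D < 1" using lam by (simp add: pos_less_divide_eq mult.commute)
  have "1 / (360 * lam ^ 13) \<le> 1 / 360" using l13 lam by (intro divide_left_mono) auto
  then have D2: "D < 1 / 2" using mu unfolding D_def by linarith
  have xx: "x \<bullet> x = 1" using x(2) by (simp add: dot_square_norm)
  have rY: "rayleigh_le E Y lam" using rayleigh_le_mono[OF Z YZ] lam by simp
  have D0: "D \<ge> 0" using rY x(1) xx unfolding rayleigh_le_def D_def by (metis inner_scaleR_right mult.right_neutral diff_ge_0_iff_ge)
  have mu0: "\<mu> > 0" using D2 lam by (simp add: D_def)
  have supp: "x $ v = 0" if "v \<notin> Y" for v
    using arg_cong[OF x(1), of "\<lambda>y. y $ v"] that mu0 by (simp add: adj_on_nth)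
  have sumY: "(\<Sum>v\<in>Y. (x $ v)\<^sup>2) = 1"
    unfolding xx[symmetric] inner_self_eq_sum by (rule sum.mono_neutral_left) (auto simp: supp)
  \<comment> \<open>The \<open>j\<close>-th image has squared norm at most
    \<open>lam ^ (2 * j)\<close>, and at least \<open>\<mu> ^ (2 * j)\<close> of it sits on
    \<open>Y\<close>. Only the difference is left for \<open>P\<close>; with
    \<open>2 * j \<le> 12\<close> this gives \<open>12 * lam ^ 11 * D\<close>.\<close>
  have mass: "(\<Sum>w\<in>P. (adj_power E Z j x $ w)\<^sup>2) \<le> 12 * lam ^ 11 * D" if j: "j \<in> {1..6}" for j
  proof -
    let ?y = "adj_power E Z j x"
    have ge: "?y $ v \<ge> \<mu> ^ j * x $ v" for v
      using adj_power_mono_nonneg[OF YZ x(3), of E j v] by (simp add: adj_power_eigenvector[OF x(1)])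
    have "norm ?y \<le> lam ^ j" using adj_power_norm_le[OF E Z, of j x] x(2) by simp
    then have "(norm ?y)\<^sup>2 \<le> (lam ^ j)\<^sup>2" by (intro power_mono) auto
    then have yy: "?y \<bullet> ?y \<le> lam ^ (2 * j)"
      by (simp add: dot_square_norm power_mult[symmetric] mult.commute)
    have "\<mu> ^ (2 * j) = (\<Sum>v\<in>Y. (\<mu> ^ j * x $ v)\<^sup>2)"
      by (simp add: power_mult_distrib sum_distrib_left[symmetric] sumY power_mult[symmetric] mult.commute)
    also have "\<dots> \<le> (\<Sum>v\<in>Y. (?y $ v)\<^sup>2)" using ge mu0 x(3) by (intro sum_mono power_mono) auto
    finally have "\<mu> ^ (2 * j) + (\<Sum>w\<in>P. (?y $ w)\<^sup>2) \<le> (\<Sum>v\<in>Y. (?y $ v)\<^sup>2) + (\<Sum>w\<in>P. (?y $ w)\<^sup>2)" by simp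
    also have "\<dots> = (\<Sum>v\<in>Y \<union> P. (?y $ v)\<^sup>2)" by (rule sum.union_disjoint[symmetric]) (use P in auto)
    also have "\<dots> \<le> ?y \<bullet> ?y" unfolding inner_self_eq_sum by (rule sum_mono2) auto
    finally have 1: "(\<Sum>w\<in>P. (?y $ w)\<^sup>2) \<le> lam ^ (2 * j) - \<mu> ^ (2 * j)" using yy by linarith
    obtain k where k: "2 * j = Suc k" "k \<le> 11" using j by (cases "2 * j") auto
    have "lam ^ (2 * j) - \<mu> ^ (2 * j) \<le> real (Suc k) * lam ^ k * (lam - \<mu>)"
      unfolding k(1) by (rule power_diff_le) (use mu0 D0 in \<open>auto simp: D_def\<close>)
    also have "\<dots> \<le> 12 * lam ^ 11 * D"
      unfolding D_def[symmetric] using k(2) lam D0 by (intro mult_mono power_increasing) auto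
    finally show ?thesis using 1 by linarith
  qed
  define F where "F = {u\<in>Y. real (card {w\<in>Y. E u w}) \<le> lam - 1}"
  define f where "f = restrict_vec F x"
  define g where "g = restrict_vec (- F) x"
  have xfg: "x = f + g" by (auto simp: f_def g_def vec_eq_iff)
  have fg: "f \<bullet> g = 0" unfolding inner_vec_def by (rule sum.neutral) (simp add: f_def g_def)
  \<comment> \<open>Each vertex of \<open>Y - F\<close> lies in some \<open>N j w\<close>, from
    which \<open>w\<close> is reached in \<open>j\<close> steps, so the value at \<open>w\<close> is
    at least the sum of \<open>x\<close> over \<open>N j w\<close>. Six values of \<open>j\<close>
    turn 12 into 72.\<close>
  have gg: "g \<bullet> g \<le> 72 * lam ^ 11 * D"
  proof -
    define N where "N j w = {u. adj_power E Z j (axis w 1) $ u \<ge> 1}" for j w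
    have pt: "(if u \<in> - F then (x $ u)\<^sup>2 else 0) \<le> (\<Sum>j\<in>{1..6}. \<Sum>w\<in>P. if u \<in> N j w then (x $ u)\<^sup>2 else 0)" for u
    proof (cases "u \<in> Y - F")
      case True
      then obtain w j where wj: "w \<in> P" "j \<in> {1..6}" "u \<in> N j w"
        using near[of u] by (auto simp: F_def N_def)
      have "(x $ u)\<^sup>2 = (if u \<in> N j w then (x $ u)\<^sup>2 else 0)" using wj by simp
      also have "\<dots> \<le> (\<Sum>w\<in>P. if u \<in> N j w then (x $ u)\<^sup>2 else 0)"
        by (rule member_le_sum) (use wj in auto)
      also have "\<dots> \<le> (\<Sum>j\<in>{1..6}. \<Sum>w\<in>P. if u \<in> N j w then (x $ u)\<^sup>2 else 0)"
        by (rule member_le_sum[where f = "\<lambda>j. \<Sum>w\<in>P. if u \<in> N j w then (x $ u)\<^sup>2 else 0"])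
          (use wj in \<open>auto intro!: sum_nonneg\<close>)
      finally show ?thesis using True by simp
    next
      case False
      then have "(if u \<in> - F then (x $ u)\<^sup>2 else 0) = 0" using supp[of u] by auto
      then show ?thesis by (auto intro!: sum_nonneg)
    qed
    have "g \<bullet> g = (\<Sum>u\<in>UNIV. if u \<in> - F then (x $ u)\<^sup>2 else 0)"
      unfolding g_def restrict_vec_inner_self by (simp add: sum.If_cases Compl_eq)
    also have "\<dots> \<le> (\<Sum>u\<in>UNIV. \<Sum>j\<in>{1..6}. \<Sum>w\<in>P. if u \<in> N j w then (x $ u)\<^sup>2 else 0)"
      by (rule sum_mono[OF pt])
    also have "\<dots> = (\<Sum>j\<in>{1..6}. \<Sum>u\<in>UNIV. \<Sum>w\<in>P. if u \<in> N j w then (x $ u)\<^sup>2 else 0)" by (rule sum.swap)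
    also have "\<dots> = (\<Sum>j\<in>{1..6}. \<Sum>w\<in>P. \<Sum>u\<in>UNIV. if u \<in> N j w then (x $ u)\<^sup>2 else 0)"
      by (intro sum.cong refl sum.swap)
    also have "\<dots> \<le> (\<Sum>j\<in>{1..6}. \<Sum>w\<in>P. (adj_power E Z j x $ w)\<^sup>2)"
    proof (intro sum_mono)
      fix j w
      have pos: "adj_power E Z j (axis w 1) $ u \<ge> 0" for u
        using adj_power_mono_nonneg[of Z Z "axis w 1" E j u] by (simp add: axis_def)
      have "(\<Sum>u\<in>UNIV. if u \<in> N j w then (x $ u)\<^sup>2 else 0) = (\<Sum>u\<in>N j w. (x $ u)\<^sup>2)"
        by (simp add: sum.If_cases)
      also have "\<dots> \<le> (\<Sum>u\<in>N j w. x $ u)\<^sup>2" by (rule sum_squares_le_square_sum) (use x(3) in auto)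
      also have "\<dots> \<le> (adj_power E Z j x $ w)\<^sup>2"
      proof (rule power_mono)
        have "(\<Sum>u\<in>N j w. x $ u) \<le> (\<Sum>u\<in>N j w. x $ u * adj_power E Z j (axis w 1) $ u)"
        proof (rule sum_mono)
          fix u assume "u \<in> N j w"
          then have "x $ u * 1 \<le> x $ u * adj_power E Z j (axis w 1) $ u"
            using x(3)[of u] by (intro mult_left_mono) (auto simp: N_def)
          then show "x $ u \<le> x $ u * adj_power E Z j (axis w 1) $ u" by simp
        qed
        also have "\<dots> \<le> (\<Sum>u\<in>UNIV. x $ u * adj_power E Z j (axis w 1) $ u)"
          by (rule sum_mono2) (use x(3) pos in auto)
        also have "\<dots> = x \<bullet> adj_power E Z j (axis w 1)" by (simp add: inner_vec_def)
        also have "\<dots> = adj_power E Z j x $ w" by (simp add: adj_power_inner[OF E, symmetric] inner_axis)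
        finally show "(\<Sum>u\<in>N j w. x $ u) \<le> adj_power E Z j x $ w" .
      qed (use x(3) in \<open>auto intro!: sum_nonneg\<close>)
      finally show "(\<Sum>u\<in>UNIV. if u \<in> N j w then (x $ u)\<^sup>2 else 0) \<le> (adj_power E Z j x $ w)\<^sup>2" .
    qed
    also have "\<dots> \<le> (\<Sum>j\<in>{1..6::nat}. 12 * lam ^ 11 * D)" by (rule sum_mono[OF mass])
    also have "\<dots> = 72 * lam ^ 11 * D" by simp
    finally show ?thesis .
  qed
  have F: "rayleigh_le E F (lam - 1)"
  proof (rule rayleigh_le_of_degree[OF E])
    fix u assume u: "u \<in> F"
    have "card {w\<in>F. E u w} \<le> card {w\<in>Y. E u w}" by (rule card_mono) (auto simp: F_def)
    then show "real (card {w\<in>F. E u w}) \<le> lam - 1" using u by (simp add: F_def)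
  qed (use lam in simp)
  have "f \<bullet> (?B *v f) = f \<bullet> (adj_on E F *v f)"
    using adj_on_quadratic[of F Y f E] by (simp add: f_def F_def)
  also have "\<dots> \<le> (lam - 1) * (f \<bullet> f)" using F by (simp add: rayleigh_le_def)
  finally have 1: "f \<bullet> (?B *v f) \<le> (lam - 1) * (f \<bullet> f)" .
  have 2: "f \<bullet> (?B *v g) \<le> norm f * (lam * norm g)"
    using norm_cauchy_schwarz[of f "?B *v g"] mult_left_mono[OF rayleigh_le_norm_le[OF E rY, of g], of "norm f"] by simp
  \<comment> \<open>The eigenvector equation tested against \<open>f\<close>: on \<open>F\<close>
    the form reaches only \<open>lam - 1\<close>, while \<mu> is above \<open>lam - 1 / 2\<close>,
    so the deficit must come from \<open>g\<close>, and
    \<open>norm f \<le> 2 * lam * norm g\<close>.\<close>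
  have "f \<bullet> x = f \<bullet> f" using fg by (simp add: xfg inner_add_right)
  then have "\<mu> * (f \<bullet> f) = f \<bullet> (?B *v x)" by (simp add: x(1))
  moreover have "f \<bullet> (?B *v x) = f \<bullet> (?B *v f) + f \<bullet> (?B *v g)"
    by (simp add: xfg matrix_vector_right_distrib inner_add_right)
  ultimately have "\<mu> * (f \<bullet> f) \<le> (lam - 1) * (f \<bullet> f) + norm f * (lam * norm g)"
    using 1 2 by linarith
  then have "(1 - D) * (norm f * norm f) \<le> norm f * (lam * norm g)"
    by (simp add: D_def dot_square_norm power2_eq_square algebra_simps)
  moreover have "1 / 2 * (norm f * norm f) \<le> (1 - D) * (norm f * norm f)"
    using D2 by (intro mult_right_mono) auto
  ultimately have "norm f * norm f \<le> norm f * (2 * lam * norm g)" by simp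
  then have "norm f \<le> 2 * lam * norm g"
    using lam by (cases "norm f = 0") (auto simp: mult_le_cancel_left)
  then have "(norm f)\<^sup>2 \<le> (2 * lam * norm g)\<^sup>2" by (intro power_mono) auto
  then have ff: "f \<bullet> f \<le> 4 * lam\<^sup>2 * (g \<bullet> g)" by (simp add: dot_square_norm power_mult_distrib)
  \<comment> \<open>Origin of 360: the factor \<open>5 * lam\<^sup>2\<close> from comparing
    \<open>f\<close> with \<open>g\<close>, times \<open>72 * lam ^ 11\<close>.\<close>
  have "1 = f \<bullet> f + g \<bullet> g"
    using xx fg by (simp add: xfg inner_add_left inner_add_right inner_commute)
  also have "\<dots> \<le> (4 * lam\<^sup>2 + 1) * (g \<bullet> g)" using ff by (simp add: algebra_simps)
  also have "\<dots> \<le> (5 * lam\<^sup>2) * (72 * lam ^ 11 * D)"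
  proof (rule mult_mono)
    have "1 \<le> lam\<^sup>2" using lam by simp
    then show "4 * lam\<^sup>2 + 1 \<le> 5 * lam\<^sup>2" by simp
  qed (use gg in auto)
  also have "\<dots> = 360 * lam ^ 13 * D" by (simp add: power_add[symmetric])
  finally show False using D1 by simp
qed

section \<open>Connected components\<close>

definition component :: "('v \<Rightarrow> 'v \<Rightarrow> bool) \<Rightarrow> 'v \<Rightarrow> 'v set" where
  "component E v = {w. E\<^sup>*\<^sup>* v w}"

lemma component_self [simp]: "v \<in> component E v"
  by (simp add: component_def)

lemma component_step: "w \<in> component E v \<Longrightarrow> E w u \<Longrightarrow> u \<in> component E v"
  by (simp add: component_def)

lemma component_eq:
  assumes "symp E" "w \<in> component E v"
  shows "component E w = component E v"
proof -
  have "E\<^sup>*\<^sup>* v w" using assms(2) by (simp add: component_def)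
  moreover from this have "E\<^sup>*\<^sup>* w v" using symp_rtranclp[OF assms(1)] by (blast dest: sympD)
  ultimately show ?thesis unfolding component_def by (auto intro: rtranclp_trans)
qed

lemma nbhd_subset_component: "nbhd E R v \<subseteq> component E v"
  by (induction R) (auto intro: component_step)

lemma component_subset_nbhd:
  assumes "nbhd E (Suc R) v = nbhd E R v"
  shows "component E v \<subseteq> nbhd E R v"
proof
  fix w assume "w \<in> component E v"
  then have "E\<^sup>*\<^sup>* v w" by (simp add: component_def)
  then show "w \<in> nbhd E R v"
  proof (induction rule: rtranclp_induct)
    case (step y z)
    then have "z \<in> nbhd E (Suc R) v" by auto
    then show ?case by (simp only: assms)
  qed simp
qed

lemma restrict_vec_component_eigenvector:
  assumes E: "simple_graph E" and x: "adj_matrix E *v x = c *\<^sub>R x"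
  shows "adj_matrix E *v restrict_vec (component E v) x = c *\<^sub>R restrict_vec (component E v) x"
proof (rule vec_eq_iff[THEN iffD2], rule allI)
  fix w
  have sym: "E u w \<longleftrightarrow> E w u" for u using E by (auto simp: simple_graph_def symp_def)
  have xw: "(\<Sum>u\<in>{u. E w u}. x $ u) = c * x $ w"
    using arg_cong[OF x, of "\<lambda>y. y $ w"] adj_on_nth[of E UNIV x w] by (simp add: adj_on_UNIV)
  have "(adj_matrix E *v restrict_vec (component E v) x) $ w = (\<Sum>u\<in>{u. E w u}. restrict_vec (component E v) x $ u)"
    using adj_on_nth[of E UNIV "restrict_vec (component E v) x" w] by (simp add: adj_on_UNIV)
  also have "\<dots> = (\<Sum>u\<in>{u. E w u}. if w \<in> component E v then x $ u else 0)"
    by (rule sum.cong) (use component_step[of _ E v] sym in auto)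
  also have "\<dots> = (c *\<^sub>R restrict_vec (component E v) x) $ w" using xw by simp
  finally show "(adj_matrix E *v restrict_vec (component E v) x) $ w = (c *\<^sub>R restrict_vec (component E v) x) $ w" .
qed

text \<open>The largest eigenvalue of a connected graph is simple: for an eigenvector \<open>x\<close>, the vector \<open>|x|\<close>
  is also one, and it vanishes nowhere unless it is zero.\<close>

lemma eigenvector_zero_on_component:
  fixes E :: "'v::finite \<Rightarrow> 'v \<Rightarrow> bool"
  assumes E: "simple_graph E" and x: "adj_matrix E *v x = c *\<^sub>R x"
    and rayleigh_le: "rayleigh_le E (component E v) c" and v: "x $ v = 0" and w: "w \<in> component E v"
  shows "x $ w = 0"
proof -
  let ?C = "component E v"
  define z where "z = restrict_vec ?C x"
  define y where "y = abs_vec z"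
  have z: "adj_on E ?C *v z = c *\<^sub>R z"
    unfolding z_def by (rule eigenvector_supported(1)[OF restrict_vec_component_eigenvector[OF E x]]) simp
  have yy: "y \<bullet> y = z \<bullet> z" by (simp add: y_def abs_vec_inner_self)
  have "c * (y \<bullet> y) \<le> y \<bullet> (adj_on E ?C *v y)"
    using adj_on_abs_vec[of z E ?C] z yy by (simp add: y_def)
  moreover have le: "u \<bullet> (adj_on E ?C *v u) \<le> c * (u \<bullet> u)" for u using rayleigh_le by (simp add: rayleigh_le_def)
  ultimately have "y \<bullet> (adj_on E ?C *v y) = c * (y \<bullet> y)" by (intro antisym)
  then have y: "adj_on E ?C *v y = c *\<^sub>R y"
    by (rule maximizer_eigenvector[OF transpose_adj_on[OF E] subspace_UNIV UNIV_I le UNIV_I])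
  have "E\<^sup>*\<^sup>* v w" using w by (simp add: component_def)
  then have "w \<in> ?C \<and> y $ w = 0"
  proof (induction rule: rtranclp_induct)
    case base
    then show ?case using v by (simp add: y_def z_def)
  next
    case (step a b)
    have b: "b \<in> ?C" by (rule component_step[of a]) (use step in simp_all)
    have "(\<Sum>u\<in>{u\<in>?C. E a u}. y $ u) = 0"
      using arg_cong[OF y, of "\<lambda>y. y $ a"] step.IH by (simp add: adj_on_nth)
    then have "\<forall>u\<in>{u\<in>?C. E a u}. y $ u = 0"
      by (subst (asm) sum_nonneg_eq_0_iff) (auto simp: y_def)
    then show ?case using b step.hyps by auto
  qed
  then show ?thesis using w by (simp add: y_def z_def)
qed

text \<open>At a coordinate of largest modulus in the component there are at least
  \<open>\<bar>c\<bar>\<close> neighbours in the support; the vertex itself adds 1.\<close>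

lemma card_component_ge:
  fixes E :: "'v::finite \<Rightarrow> 'v \<Rightarrow> bool"
  assumes E: "simple_graph E" and x: "adj_matrix E *v x = c *\<^sub>R x" and v: "x $ v \<noteq> 0"
  shows "c + 1 \<le> real (card (component E v))"
proof -
  let ?y = "restrict_vec (component E v) x"
  have "?y $ v \<noteq> 0" using v by simp
  moreover have "real (card {w. E u w}) \<le> real CARD('v)" for u by (simp add: card_mono)
  ultimately obtain u where u: "?y $ u \<noteq> 0" "\<bar>c\<bar> \<le> real (card {w. E u w \<and> ?y $ w \<noteq> 0})"
    using eigenvalue_le_degree[OF _ restrict_vec_component_eigenvector[OF E x]] by blast
  have uC: "u \<in> component E v" using u(1) by (auto split: if_splits)
  have "u \<notin> {w. E u w}" using E by (auto simp: simple_graph_def irreflp_def)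
  then have "card {w. E u w \<and> ?y $ w \<noteq> 0} < card (component E v)"
    by (intro psubset_card_mono) (use uC in \<open>auto split: if_splits\<close>)
  then show ?thesis using u(2) by linarith
qed

lemma eig_mult_le_components:
  fixes E :: "'v::finite \<Rightarrow> 'v \<Rightarrow> bool"
  assumes E: "simple_graph E" and c: "c > 0"
  shows "real (eig_mult E c) \<le> real (card {v. rayleigh_le E (component E v) c}) / (c + 1)
    + real (dim {x. adj_matrix E *v x = c *\<^sub>R x \<and> (\<forall>v. rayleigh_le E (component E v) c \<longrightarrow> x $ v = 0)})"
proof -
  have sym: "symp E" using E by (simp add: simple_graph_def)
  define G where "G = {C \<in> range (component E). rayleigh_le E C c \<and> real (card C) \<ge> c + 1}"
  define r where "r C = (SOME v. component E v = C)" for C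
  have r: "component E (r C) = C" if "C \<in> range (component E)" for C
    unfolding r_def by (rule someI_ex) (use that in auto)
  let ?K = "{x. adj_matrix E *v x = c *\<^sub>R x}"
  let ?K1 = "{x. adj_matrix E *v x = c *\<^sub>R x \<and> (\<forall>v. rayleigh_le E (component E v) c \<longrightarrow> x $ v = 0)}"
  have fin: "finite G" by (simp add: G_def)
  have "disjoint G"
  proof (rule disjointI)
    fix A B assume "A \<in> G" "B \<in> G" "A \<noteq> B"
    then obtain a b where ab: "A = component E a" "B = component E b" by (auto simp: G_def)
    show "A \<inter> B = {}"
      using \<open>A \<noteq> B\<close> component_eq[OF sym] unfolding ab by blast
  qed
  then have "real (card (\<Union>G)) = (\<Sum>C\<in>G. real (card C))"
    by (subst card_Union_disjoint) auto
  also have "\<dots> \<ge> (\<Sum>C\<in>G. c + 1)" by (rule sum_mono) (simp add: G_def)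
  finally have "real (card G) * (c + 1) \<le> real (card (\<Union>G))" by simp
  also have "card (\<Union>G) \<le> card {v. rayleigh_le E (component E v) c}"
    by (rule card_mono) (auto simp: G_def component_eq[OF sym])
  finally have cG: "real (card G) \<le> real (card {v. rayleigh_le E (component E v) c}) / (c + 1)"
    using c by (simp add: pos_le_divide_eq)
  \<comment> \<open>One zero condition at a representative removes a whole component of
    \<open>G\<close>. The remaining components with small Rayleigh quotient have fewer than
    \<open>c + 1\<close> vertices and carry no eigenvector.\<close>
  have "{x\<in>?K. \<forall>v\<in>r ` G. x $ v = 0} \<subseteq> ?K1"
  proof clarify
    fix x v assume x: "adj_matrix E *v x = c *\<^sub>R x" and 0: "\<forall>v\<in>r ` G. x $ v = 0"
      and rayleigh_le: "rayleigh_le E (component E v) c"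
    show "x $ v = 0"
    proof (rule ccontr)
      assume "x $ v \<noteq> 0"
      then have "component E v \<in> G" using card_component_ge[OF E x] rayleigh_le by (simp add: G_def)
      then have "x $ r (component E v) = 0" using 0 by blast
      moreover have "component E (r (component E v)) = component E v" by (rule r) simp
      ultimately have "x $ v = 0"
        using eigenvector_zero_on_component[OF E x, of "r (component E v)" v] rayleigh_le by simp
      with \<open>x $ v \<noteq> 0\<close> show False by simp
    qed
  qed
  then have "dim {x\<in>?K. \<forall>v\<in>r ` G. x $ v = 0} \<le> dim ?K1" by (rule dim_subset)
  moreover have "card (r ` G) \<le> card G" by (rule card_image_le[OF fin])
  ultimately have "eig_mult E c \<le> card G + dim ?K1"
    using dim_vanishing[OF subspace_eigenspace, of "adj_matrix E" c "r ` G"] unfolding eig_mult_def by linarith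
  then show ?thesis using cG by linarith
qed

section \<open>The large component and the second bound\<close>

text \<open>A walk of length at most \<open>R\<close> between \<open>w\<close> and \<open>u\<close>
  stays in the ball around \<open>u\<close>, hence in \<open>Z\<close>. Its length \<open>j\<close>
  is left open, since parity may rule out a prescribed one.\<close>

lemma exists_walk_value:
  fixes E :: "'v::finite \<Rightarrow> 'v \<Rightarrow> bool"
  assumes E: "simple_graph E" and "u \<in> nbhd E R w" "nbhd E R u \<subseteq> Z"
  shows "\<exists>j\<le>R. adj_power E Z j (axis w 1) $ u \<ge> 1"
  using assms(2,3)
proof (induction R arbitrary: u)
  case 0
  then show ?case by (simp add: axis_def)
next
  case (Suc R)
  have sym: "symp E" using E by (simp add: simple_graph_def)
  show ?case
  proof (cases "u \<in> nbhd E R w")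
    case True
    moreover have "nbhd E R u \<subseteq> Z" using Suc.prems(2) by auto
    ultimately show ?thesis using Suc.IH[of u] le_SucI by blast
  next
    case False
    then obtain t where t: "t \<in> nbhd E R w" "E t u" using Suc.prems by auto
    have ut: "E u t" using t(2) sym by (auto dest: sympD)
    have "nbhd E R t \<subseteq> nbhd E (Suc R) u"
      using nbhd_trans[of t E 1 u _ R] ut by auto
    then obtain j where j: "j \<le> R" "adj_power E Z j (axis w 1) $ t \<ge> 1"
      using Suc.IH[OF t(1)] Suc.prems(2) by blast
    have uZ: "u \<in> Z" "t \<in> Z" using Suc.prems(2) \<open>nbhd E R t \<subseteq> nbhd E (Suc R) u\<close> nbhd_self[of u E "Suc R"] nbhd_self[of t E R] by blast+
    have "adj_power E Z j (axis w 1) $ t \<le> (\<Sum>t\<in>{t\<in>Z. E u t}. adj_power E Z j (axis w 1) $ t)"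
    proof (rule member_le_sum)
      fix t
      show "0 \<le> adj_power E Z j (axis w 1) $ t"
        using adj_power_mono_nonneg[of Z Z "axis w 1" E j t] by (simp add: axis_def)
    qed (use uZ ut in auto)
    then have "adj_power E Z (Suc j) (axis w 1) $ u \<ge> 1"
      using uZ j(2) by (simp add: adj_power_Suc adj_on_nth)
    then show ?thesis using j(1) by (intro exI[of _ "Suc j"]) simp
  qed
qed

text \<open>Disjointness of the chosen balls bounds their number; by maximality every other large
  ball meets one of them, so its centre is within twice the radius.\<close>

lemma maximal_packing:
  fixes E :: "'v::finite \<Rightarrow> 'v \<Rightarrow> bool" and k :: real
  assumes sym: "symp E"
  obtains P where "P \<subseteq> component E c" "real (card P) * k \<le> real (card (component E c))"
    "\<And>u. u \<in> component E c \<Longrightarrow> real (card (nbhd E R u)) \<ge> k \<Longrightarrow> \<exists>w\<in>P. u \<in> nbhd E (2 * R) w"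
proof -
  define A where "A = {P. P \<subseteq> component E c \<and> (\<forall>v\<in>P. real (card (nbhd E R v)) \<ge> k) \<and> disjoint_family_on (nbhd E R) P}"
  have "{} \<in> A" by (simp add: A_def disjoint_family_on_def)
  then have "\<exists>P\<in>A. \<forall>Q\<in>A. P \<subseteq> Q \<longrightarrow> P = Q" by (intro finite_has_maximal) auto
  then obtain P where PA: "P \<in> A" and mx: "\<And>Q. Q \<in> A \<Longrightarrow> P \<subseteq> Q \<Longrightarrow> P = Q" by blast
  have P: "P \<subseteq> component E c" "\<And>v. v \<in> P \<Longrightarrow> real (card (nbhd E R v)) \<ge> k" "disjoint_family_on (nbhd E R) P"
    using PA by (auto simp: A_def)
  show ?thesis
  proof (rule that)
    show PC: "P \<subseteq> component E c" using P by simp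
    have "real (card P) * k = (\<Sum>v\<in>P. k)" by simp
    also have "\<dots> \<le> (\<Sum>v\<in>P. real (card (nbhd E R v)))" by (rule sum_mono) (use P in auto)
    also have "\<dots> = real (card (\<Union>v\<in>P. nbhd E R v))"
      by (subst card_UN_disjoint) (use P in \<open>auto simp: disjoint_family_on_def\<close>)
    also have "card (\<Union>v\<in>P. nbhd E R v) \<le> card (component E c)"
    proof (rule card_mono[OF finite UN_least])
      fix v assume "v \<in> P"
      then have "component E v = component E c" using PC by (intro component_eq[OF sym]) blast
      then show "nbhd E R v \<subseteq> component E c" using nbhd_subset_component[of E R v] by simp
    qed
    finally show "real (card P) * k \<le> real (card (component E c))" by simp
    fix u assume u: "u \<in> component E c" "real (card (nbhd E R u)) \<ge> k"
    show "\<exists>w\<in>P. u \<in> nbhd E (2 * R) w"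
    proof (cases "u \<in> P")
      case True
      then show ?thesis using nbhd_self[of u E "2 * R"] by blast
    next
      case False
      then have "insert u P \<notin> A" using mx[of "insert u P"] by auto
      then have "\<not> disjoint_family_on (nbhd E R) (insert u P)" using u P by (auto simp: A_def)
      then have "nbhd E R u \<inter> (\<Union>w\<in>P. nbhd E R w) \<noteq> {}"
        using P(3) False by (simp add: disjoint_family_on_insert)
      then obtain w t where w: "w \<in> P" "t \<in> nbhd E R w" "t \<in> nbhd E R u" by blast
      have "u \<in> nbhd E (R + R) w" by (rule nbhd_trans[OF w(2) nbhd_sym[OF sym w(3)]])
      then show ?thesis using w(1) by (auto simp: mult_2)
    qed
  qed
qed

text \<open>The relative gap is \<open>1 / (360 * lam ^ 14)\<close>, so \<open>t\<close> steps gain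
  \<open>exp (- t / (360 * lam ^ 14))\<close>, and \<open>720 * lam ^ 14 * log 2 (lam + 2)\<close>
  steps suffice for a gain of \<open>(lam + 2)\<^sup>2\<close>.\<close>

lemma gap_power_le:
  fixes lam :: real and t :: nat
  assumes lam: "lam \<ge> 1" and t: "real t \<ge> (2 * lam + 2) ^ 14 * log 2 (lam + 2) - 16"
  shows "(lam - 1 / (360 * lam ^ 13)) ^ t \<le> lam ^ t / ((lam + 1) * (lam + 2))"
proof -
  define g where "g = log 2 (lam + 2)"
  have g1: "g \<ge> 1" using lam by (simp add: g_def le_log_iff)
  have ln2: "ln 2 \<le> (1 :: real)" using ln2_le_25_over_36 by simp
  have l14: "lam ^ 14 \<ge> 1" using lam by simp
  \<comment> \<open>The 16 steps lost to rounding and to the larger radius are absorbed because 720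
    + 16 is below \<open>2 ^ 14\<close>.\<close>
  have "720 * lam ^ 14 * g + 16 \<le> 720 * lam ^ 14 * g + 16 * (lam ^ 14 * g)"
    using mult_mono[OF l14 g1] lam by (simp add: mult.commute)
  also have "\<dots> \<le> 2 ^ 14 * (lam ^ 14 * g)" using lam g1 by simp
  also have "\<dots> \<le> 2 ^ 14 * ((lam + 1) ^ 14 * g)"
    using lam g1 by (intro mult_left_mono mult_right_mono power_mono) auto
  also have "\<dots> = (2 * lam + 2) ^ 14 * g"
  proof -
    have "2 * lam + 2 = 2 * (lam + 1)" by simp
    then show ?thesis by (simp only: power_mult_distrib mult.assoc)
  qed
  finally have "720 * lam ^ 14 * g \<le> real t" using t by (simp add: g_def)
  then have big: "2 * g \<le> real t / (360 * lam ^ 14)" using lam by (simp add: pos_le_divide_eq mult_ac)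
  have l13: "lam ^ 13 \<ge> 1" using lam by simp
  have "lam - 1 / (360 * lam ^ 13) = lam * (1 - 1 / (360 * lam ^ 14))"
    using lam by (simp add: field_simps power_Suc[symmetric] del: power_Suc) 
  then have "(lam - 1 / (360 * lam ^ 13)) ^ t = lam ^ t * (1 - 1 / (360 * lam ^ 14)) ^ t"
    by (simp add: power_mult_distrib)
  also have "(1 - 1 / (360 * lam ^ 14)) ^ t \<le> exp (- (1 / (360 * lam ^ 14))) ^ t"
  proof (rule power_mono)
    have "1 / (360 * lam ^ 14) \<le> 1" using l14 by (simp add: divide_le_eq)
    then show "0 \<le> 1 - 1 / (360 * lam ^ 14)" by simp
    show "1 - 1 / (360 * lam ^ 14) \<le> exp (- (1 / (360 * lam ^ 14)))"
      using exp_ge_add_one_self[of "- (1 / (360 * lam ^ 14))"] by simp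
  qed
  also have "\<dots> = exp (- (real t / (360 * lam ^ 14)))" by (simp flip: exp_of_nat_mult)
  also have "\<dots> \<le> exp (- (2 * ln (lam + 2)))"
  proof -
    have "ln (lam + 2) = g * ln 2" by (simp add: g_def log_def)
    also have "\<dots> \<le> g * 1" using ln2 g1 by (intro mult_left_mono) auto
    finally show ?thesis using big by simp
  qed
  also have "\<dots> = 1 / ((lam + 2) * (lam + 2))"
    using lam by (simp add: exp_minus exp_double inverse_eq_divide power2_eq_square)
  also have "\<dots> \<le> 1 / ((lam + 1) * (lam + 2))"
    using lam by (intro divide_left_mono mult_right_mono) auto
  finally show ?thesis using lam by (simp add: mult_left_mono)
qed

lemma dim_large_component_le:
  fixes E :: "'v::finite \<Rightarrow> 'v \<Rightarrow> bool"
  assumes E: "simple_graph E" and lam: "lam = second_eigenvalue E" "lam > 0"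
    and deg: "\<And>v. real (card {w. E v w}) \<le> d" and d: "d \<ge> 2"
    and M: "M = (2 * lam + 2) ^ 14 * log 2 (lam + 2)"
    and large: "real (card (component E c)) > d powr M"
  shows "real (dim {x. adj_matrix E *v x = lam *\<^sub>R x \<and> (\<forall>v. v \<notin> component E c \<longrightarrow> x $ v = 0)})
    \<le> real (card (component E c)) / (lam + 1) + d powr M"
proof -
  have sym: "symp E" using E by (simp add: simple_graph_def)
  let ?C = "component E c"
  let ?n = "real (card ?C)"
  define bad where "bad R = {v. \<not> rayleigh_le E (nbhd E R v) lam}" for R
  have bad: "real (card (bad R)) \<le> d ^ (2 * R + 2)" for R
    unfolding bad_def lam(1) by (rule card_bad_vertices_le[OF E _ deg d]) (use lam in simp)
  have M1: "M \<ge> 16384"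
  proof -
    have "2 ^ 14 * 1 \<le> (2 * lam + 2) ^ 14 * log 2 (lam + 2)"
      using lam(2) by (intro mult_mono power_mono) (auto simp: le_log_iff)
    then show ?thesis unfolding M by simp
  qed
  have dM: "d ^ k \<le> d powr M" if "k \<le> 16384" for k
  proof -
    have "d ^ k = d powr real k" using d by (simp add: powr_realpow)
    also have "\<dots> \<le> d powr M" using d M1 that by (intro powr_mono) auto
    finally show ?thesis .
  qed
  \<comment> \<open>A ball that stops growing is the whole component, but for
    \<open>k \<le> 4\<close> it has at most \<open>d ^ 5\<close> vertices, fewer than the
    component.\<close>
  have grow: "card (nbhd E k v) < card (nbhd E (Suc k) v)" if v: "v \<in> ?C" and k: "k \<le> 4" for k v
  proof (rule psubset_card_mono)
    have "nbhd E (Suc k) v \<noteq> nbhd E k v"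
    proof
      assume "nbhd E (Suc k) v = nbhd E k v"
      then have "?C \<subseteq> nbhd E k v" using component_subset_nbhd component_eq[OF sym v] by metis
      then have "card ?C \<le> card (nbhd E k v)" by (intro card_mono) auto
      moreover have "real (card (nbhd E k v)) \<le> d powr M"
        using card_nbhd_le[of E d k v] deg d dM[of "k + 1"] k by fastforce
      ultimately show False using large by linarith
    qed
    then show "nbhd E k v \<subset> nbhd E (Suc k) v" by auto
  qed simp
  have card_nb1: "card (nbhd E 1 v) = card {w. E v w} + 1" for v
  proof -
    have "nbhd E 1 v = insert v {w. E v w}" by auto
    moreover have "v \<notin> {w. E v w}" using E by (auto simp: simple_graph_def irreflp_def)
    ultimately show ?thesis by simp
  qed
  \<comment> \<open>For \<open>lam < 1\<close> a vertex with a good ball of radius 1 would have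
    degree less than 1 and be isolated. So all of the component would be bad, and there are too few
    bad vertices for that.\<close>
  have lam1: "lam \<ge> 1"
  proof (rule ccontr)
    assume l: "\<not> lam \<ge> 1"
    have "?C \<subseteq> bad 1"
    proof
      fix v assume v: "v \<in> ?C"
      show "v \<in> bad 1"
      proof (rule ccontr)
        assume "v \<notin> bad 1"
        then have "real (card {w\<in>nbhd E 1 v. E v w}) \<le> lam\<^sup>2"
          by (intro rayleigh_le_degree_le[OF E]) (auto simp: bad_def simp del: nbhd.simps)
        moreover have "lam\<^sup>2 < 1" using l lam(2) by (simp add: power_less_one_iff)
        moreover have "{w\<in>nbhd E 1 v. E v w} = {w. E v w}" by auto
        ultimately have "real (card {w. E v w}) < 1" by (metis order_le_less_trans)
        then have "card {w. E v w} = 0" by linarith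
        then show False using grow[OF v, of 0] card_nb1[of v] by simp
      qed
    qed
    then have "card ?C \<le> card (bad 1)" by (intro card_mono) auto
    then show False using bad[of 1] dM[of 4] large by simp
  qed
  \<comment> \<open>Good balls are required up to radius \<open>s + 6\<close>, since the gap
    argument looks six steps beyond the walk; this costs \<open>d ^ (2 * (s + 6) + 2)\<close>
    vertices, hence the 14.\<close>
  define s where "s = nat \<lfloor>(M - 14) / 2\<rfloor>"
  have s: "2 * real s + 14 \<le> M" "M - 16 \<le> 2 * real s"
  proof -
    define z where "z = real_of_int \<lfloor>(M - 14) / 2\<rfloor>"
    have "real s = z" using M1 by (simp add: s_def z_def)
    moreover have "z \<le> (M - 14) / 2" "(M - 14) / 2 < z + 1"
      using floor_correct[of "(M - 14) / 2"] by (simp_all add: z_def)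
    ultimately show "2 * real s + 14 \<le> M" "M - 16 \<le> 2 * real s" by (simp_all add: field_simps)
  qed
  define U where "U = bad (s + 6)"
  have U: "real (card U) \<le> d powr M"
  proof -
    have "real (card U) \<le> d ^ (2 * s + 14)" using bad[of "s + 6"] by (simp add: U_def add.commute)
    also have "\<dots> = d powr (2 * real s + 14)"
      using powr_realpow[of d "2 * s + 14"] d by (simp only: of_nat_add of_nat_mult of_nat_numeral)
    also have "\<dots> \<le> d powr M" using s(1) d by (intro powr_mono) auto
    finally show ?thesis .
  qed
  obtain P where P: "P \<subseteq> ?C" "real (card P) * (lam + 2) \<le> ?n"
    "\<And>u. u \<in> ?C \<Longrightarrow> real (card (nbhd E 3 u)) \<ge> lam + 2 \<Longrightarrow> \<exists>w\<in>P. u \<in> nbhd E (2 * 3) w"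
    using maximal_packing[OF sym, where k = "lam + 2" and R = 3 and c = c] by blast
  define X where "X = ?C - U - P"
  define \<mu> where "\<mu> = lam - 1 / (360 * lam ^ 13)"
  have pointwise: "(norm (adj_power E X s (axis v 1)))\<^sup>2 \<le> \<mu> ^ (2 * s)" if v: "v \<in> X" for v
  proof -
    have rayleigh_le: "rayleigh_le E (X \<inter> nbhd E s v) \<mu>"
      unfolding \<mu>_def
    proof (rule rayleigh_le_gap[OF E lam1, where Z = "nbhd E (s + 6) v" and P = P])
      show "X \<inter> nbhd E s v \<subseteq> nbhd E (s + 6) v" using nbhd_mono[of s "s + 6" E v] by auto
      show "rayleigh_le E (nbhd E (s + 6) v) lam" using v by (auto simp: X_def U_def bad_def)
      show "X \<inter> nbhd E s v \<inter> P = {}" by (auto simp: X_def)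
      fix u assume u: "u \<in> X \<inter> nbhd E s v"
        and du: "lam - 1 < real (card {w\<in>X \<inter> nbhd E s v. E u w})"
      have uC: "u \<in> ?C" "u \<notin> P" using u by (auto simp: X_def)
      have "card {w\<in>X \<inter> nbhd E s v. E u w} \<le> card {w. E u w}" by (rule card_mono) auto
      \<comment> \<open>The neighbours, \<open>u\<close> itself and two steps of strict growth: a
        degree above \<open>lam - 1\<close> thus makes the ball of radius 3 reach the packing
        threshold \<open>lam + 2\<close>, and \<open>u\<close> is within 6 of
        \<open>P\<close>.\<close>
      moreover have "card (nbhd E 3 u) \<ge> card {w. E u w} + 3"
        using grow[OF uC(1), of 1] grow[OF uC(1), of 2] card_nb1[of u]
        by (simp add: numeral_3_eq_3 numeral_2_eq_2 del: nbhd.simps)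
      ultimately have "real (card (nbhd E 3 u)) \<ge> lam + 2" using du by linarith
      then obtain w where w: "w \<in> P" "u \<in> nbhd E 6 w" using P(3)[OF uC(1)] by auto
      have "nbhd E 6 u \<subseteq> nbhd E (s + 6) v" using nbhd_trans[of u E s v _ 6] u by auto
      then obtain j where j: "j \<le> 6" "adj_power E (nbhd E (s + 6) v) j (axis w 1) $ u \<ge> 1"
        using exists_walk_value[OF E w(2)] by blast
      have "j \<noteq> 0"
      proof
        assume "j = 0"
        then have "u = w" using j(2) by (simp add: axis_def split: if_splits)
        then show False using uC(2) w(1) by simp
      qed
      then show "\<exists>w\<in>P. \<exists>j\<in>{1..6}. adj_power E (nbhd E (s + 6) v) j (axis w 1) $ u \<ge> 1"
        using j w(1) by (intro bexI[of _ w] bexI[of _ j]) auto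
    qed
    have "norm (adj_power E X s (axis v 1)) \<le> \<mu> ^ s"
      using adj_power_norm_le[OF E rayleigh_le, of s "axis v 1"] adj_power_axis_local[OF E order_refl, of X s v] by simp
    then have "(norm (adj_power E X s (axis v 1)))\<^sup>2 \<le> (\<mu> ^ s)\<^sup>2" by (intro power_mono) auto
    then show ?thesis by (simp add: power_mult[symmetric] mult.commute)
  qed
  let ?K = "{x. adj_matrix E *v x = lam *\<^sub>R x \<and> (\<forall>v. v \<notin> ?C \<longrightarrow> x $ v = 0)}"
  let ?K' = "{x\<in>?K. \<forall>v\<in>U \<union> P. x $ v = 0}"
  have K: "subspace ?K"
    by (auto simp: subspace_def matrix_vector_right_distrib scaleR_right_distrib matrix_vector_mult_scaleR)
  then have K': "subspace ?K'" by (auto simp: subspace_def)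
  have "real (dim ?K') * lam ^ (2 * s) \<le> (\<Sum>v\<in>X. (norm (adj_power E X s (axis v 1)))\<^sup>2)"
    by (rule trace_bound[OF E K']) (auto simp: X_def intro!: eigenvector_supported)
  also have "\<dots> \<le> (\<Sum>v\<in>X. \<mu> ^ (2 * s))" by (rule sum_mono[OF pointwise])
  also have "\<dots> = real (card X) * \<mu> ^ (2 * s)" by simp
  also have "\<dots> \<le> ?n * (lam ^ (2 * s) / ((lam + 1) * (lam + 2)))"
  proof (rule mult_mono)
    show "real (card X) \<le> ?n" unfolding of_nat_le_iff by (rule card_mono) (auto simp: X_def)
    show "\<mu> ^ (2 * s) \<le> lam ^ (2 * s) / ((lam + 1) * (lam + 2))"
      unfolding \<mu>_def by (rule gap_power_le[OF lam1]) (use s(2) in \<open>simp add: M\<close>)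
  qed (auto simp: power_mult)
  finally have "real (dim ?K') * lam ^ (2 * s) \<le> ?n / ((lam + 1) * (lam + 2)) * lam ^ (2 * s)" by simp
  then have dimK': "real (dim ?K') \<le> ?n / ((lam + 1) * (lam + 2))"
    using lam(2) by (simp only: mult_le_cancel_right_pos zero_less_power)
  have "real (card P) \<le> ?n / (lam + 2)" using P(2) lam(2) by (simp add: pos_le_divide_eq)
  moreover have "dim ?K \<le> card (U \<union> P) + dim ?K'" by (rule dim_vanishing[OF K])
  moreover have "card (U \<union> P) \<le> card U + card P" by (rule card_Un_le)
  \<comment> \<open>The budget closes exactly: the packing and the surviving eigenspace together
    take \<open>?n / (lam + 1)\<close>.\<close>
  moreover have "?n / (lam + 2) + ?n / ((lam + 1) * (lam + 2)) = ?n / (lam + 1)"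
    using lam(2) by (simp add: divide_simps) (simp add: algebra_simps)
  ultimately show ?thesis using U dimK' by linarith
qed

lemma eig_mult_second_le_quotient:
  fixes E :: "'v::finite \<Rightarrow> 'v \<Rightarrow> bool"
  assumes E: "simple_graph E" and lam: "lam = second_eigenvalue E" "lam > 0"
    and deg: "\<And>v. real (card {w. E v w}) \<le> d" and d: "d \<ge> 2"
    and M: "M = (2 * lam + 2) ^ 14 * log 2 (lam + 2)"
  shows "real (eig_mult E lam) \<le> real CARD('v) / (lam + 1) + d powr M"
proof -
  have sym: "symp E" using E by (simp add: simple_graph_def)
  define A where "A = {v. rayleigh_le E (component E v) lam}"
  let ?K = "{x. adj_matrix E *v x = lam *\<^sub>R x \<and> (\<forall>v. rayleigh_le E (component E v) lam \<longrightarrow> x $ v = 0)}"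
  have main: "real (eig_mult E lam) \<le> real (card A) / (lam + 1) + real (dim ?K)"
    unfolding A_def by (rule eig_mult_le_components[OF E lam(2)])
  show ?thesis
  proof (cases "A = UNIV")
    case True
    then have "rayleigh_le E (component E v) lam" for v by (auto simp: A_def)
    then have "?K \<subseteq> {0}" by (auto simp: vec_eq_iff)
    then have "dim ?K = 0" unfolding dim_eq_0 .
    moreover have "d powr M \<ge> 0" by simp
    ultimately show ?thesis using main unfolding True by linarith
  next
    case False
    then obtain c where c: "\<not> rayleigh_le E (component E c) lam" by (auto simp: A_def)
    have A: "A = - component E c"
    proof (rule set_eqI)
      fix v
      show "v \<in> A \<longleftrightarrow> v \<in> - component E c"
      proof (cases "v \<in> component E c")
        case True
        then show ?thesis using c component_eq[OF sym True] by (simp add: A_def)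
      next
        case False
        have "rayleigh_le E (component E v) lam"
        proof (rule ccontr)
          assume n: "\<not> rayleigh_le E (component E v) lam"
          have disj: "component E v \<inter> component E c = {}"
          proof (rule ccontr)
            assume "component E v \<inter> component E c \<noteq> {}"
            then obtain w where "w \<in> component E v" "w \<in> component E c" by auto
            then have "component E v = component E c" using component_eq[OF sym] by metis
            then show False using False component_self[of v E] by simp
          qed
          have nonadj: "x \<noteq> y \<and> \<not> E x y" if "x \<in> component E v" "y \<in> component E c" for x y
            using disj that component_step[OF that(1), of y] by auto
          show False
            by (rule rayleigh_le_sets_adjacent[OF E _ nonadj n[unfolded lam(1)] c[unfolded lam(1)]])
              (use lam in auto)
        qed
        then show ?thesis using False by (simp add: A_def)
      qed
    qed
    have cards: "real (card A) + real (card (component E c)) = real CARD('v)"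
      unfolding A by (metis Compl_disjoint Compl_partition card_Un_disjoint finite of_nat_add add.commute)
    have K: "?K = {x. adj_matrix E *v x = lam *\<^sub>R x \<and> (\<forall>v. v \<notin> component E c \<longrightarrow> x $ v = 0)}"
      using A by (auto simp: A_def)
    have "real (dim ?K) \<le> real (card (component E c)) / (lam + 1) + d powr M"
    proof (cases "real (card (component E c)) > d powr M")
      case True
      show ?thesis unfolding K by (rule dim_large_component_le[OF E lam deg d M True])
    next
      case False
      \<comment> \<open>A component this small is deleted outright: its size already fits into the
        error term.\<close>
      have sK: "subspace ?K"
        by (auto simp: subspace_def matrix_vector_right_distrib scaleR_right_distrib matrix_vector_mult_scaleR)
      have "x = 0" if "\<forall>v. v \<notin> component E c \<longrightarrow> x $ v = 0" "\<forall>v\<in>component E c. x $ v = 0" for x :: "real^'v"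
        using that by (simp add: vec_eq_iff) blast
      then have "{x\<in>?K. \<forall>v\<in>component E c. x $ v = 0} \<subseteq> {0}" unfolding K by blast
      then have "dim {x\<in>?K. \<forall>v\<in>component E c. x $ v = 0} = 0" unfolding dim_eq_0 .
      then have "real (dim ?K) \<le> d powr M"
        using dim_vanishing[OF sK, of "component E c"] False by linarith
      moreover have "0 \<le> real (card (component E c)) / (lam + 1)" using lam by simp
      ultimately show ?thesis by linarith
    qed
    then show ?thesis using main unfolding cards[symmetric] add_divide_distrib by linarith
  qed
qed

unused_thms

theorem theorem2p7:
  fixes E :: "'v::finite \<Rightarrow> 'v \<Rightarrow> bool"
    and n :: nat and \<Delta> lambda2 :: real
  assumes "simple_graph E"
    and "n = CARD('v)"
    and "lambda2 = second_eigenvalue E"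
    and "\<Delta> \<ge> real (max_degree E)"
    and "max_degree E \<ge> 2"
  shows "(\<Delta> \<le> real n \<longrightarrow>
            ereal (real (eig_mult E lambda2))
              \<le> 5 * ereal (real n) *
                 max (log_quotient lambda2)
                     (ereal ((log 2 (1 + log \<Delta> (real n)))\<^sup>2 / log \<Delta> (real n))))
       \<and> (\<forall>\<epsilon>. 0 < \<epsilon> \<and> \<epsilon> \<le> 1 \<and>
              log \<Delta> (real n) \<ge> inverse \<epsilon> * (2 * lambda2 + 2) ^ 14 * log 2 (lambda2 + 2) \<longrightarrow>
            ereal (real (eig_mult E lambda2))
              \<le> ereal (real n) / ereal (lambda2 + 1) + ereal (real n powr \<epsilon>))"
proof -
  define lam where "lam = lambda2"
  note E = assms(1)
  have lam: "lam = second_eigenvalue E" by (simp add: lam_def assms(3))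
  have deg: "real (card {w. E v w}) \<le> \<Delta>" for v
  proof -
    have "card {w. E v w} \<le> max_degree E" unfolding max_degree_def by (rule Max_ge) auto
    then show ?thesis using assms(4) by linarith
  qed
  have d: "\<Delta> \<ge> 2" using assms(4,5) by linarith
  have n0: "real n > 0" by (simp add: assms(2))
  have mult: "real (eig_mult E lam) \<le> real n" using eig_mult_le_card[of E lam] by (simp add: assms(2))
  have lam1: "lam \<ge> - 1"
  proof -
    have "max_degree E \<in> range (\<lambda>v. card {w. E v w})" unfolding max_degree_def by (rule Max_in) auto
    then obtain v where "card {w. E v w} \<ge> 2" using assms(5) by auto
    then have "card {w. E v w} \<noteq> 0" by linarith
    then obtain w where "E v w" by (metis card.empty empty_Collect_eq)
    then have "v \<noteq> w" using E by (auto simp: simple_graph_def irreflp_def)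
    then show ?thesis unfolding lam by (rule second_eigenvalue_ge_minus_one[OF E])
  qed
  have part1: "ereal (real (eig_mult E lam))
      \<le> 5 * ereal (real n) * max (log_quotient lam) (ereal ((log 2 (1 + log \<Delta> (real n)))\<^sup>2 / log \<Delta> (real n)))"
    (is "_ \<le> 5 * _ * max _ (ereal ?r)") if dn: "\<Delta> \<le> real n"
  proof -
    \<comment> \<open>At \<open>-1\<close> the quotient is infinite, and on \<open>(-1, 0]\<close>
      it is at least 1 because \<open>ln (1 + x) \<le> x\<close> and \<open>ln 2 \<le> 1\<close>; in
      both cases the trivial bound \<open>n\<close> suffices.\<close>
    consider "lam = - 1" | "- 1 < lam" "lam \<le> 0" | "lam > 0" using lam1 by linarith
    then show ?thesis
    proof cases
      case 1
      then show ?thesis using n0 by (simp add: log_quotient_def max_def)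
    next
      case 2
      have "\<exists>q\<ge>1. log_quotient lam = ereal q"
      proof (cases "lam = 0")
        case True
        have "ln 2 \<le> (1 :: real)" using ln2_le_25_over_36 by simp
        then show ?thesis using True by (auto simp: log_quotient_def log_def intro!: exI[of _ "1 / ln 2"])
      next
        case False
        have l2: "ln 2 \<le> (1 :: real)" "ln 2 > (0 :: real)" using ln2_le_25_over_36 by simp_all
        have ln: "ln (lam + 1) \<le> lam" using ln_le_minus_one[of "lam + 1"] 2 by simp
        have "lam * ln 2 \<ge> lam * 1" using 2 l2 by (intro mult_left_mono_neg) auto
        then have "ln (lam + 1) \<le> lam * ln 2" using ln by simp
        then have "log 2 (lam + 1) \<le> lam" using l2 by (simp add: log_def divide_le_eq)
        then have "log 2 (lam + 1) / lam \<ge> 1" using False 2 by (simp add: neg_le_divide_eq)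
        then show ?thesis using False 2 by (simp add: log_quotient_def)
      qed
      then obtain q where q: "q \<ge> 1" "log_quotient lam = ereal q" by auto
      have "real (eig_mult E lam) \<le> real n * 1" using mult by simp
      also have "\<dots> \<le> 5 * real n * max q ?r" using q n0 by (intro mult_mono) auto
      finally show ?thesis using q by (simp add: ereal_max[symmetric] del: ereal_max)
    next
      case 3
      have "real (eig_mult E lam) \<le> 5 * real n * max (log 2 (lam + 1) / lam) ?r"
        using eig_mult_second_le_max[OF E lam 3 deg d] dn unfolding assms(2) by simp
      moreover have "log_quotient lam = ereal (log 2 (lam + 1) / lam)" using 3 by (simp add: log_quotient_def)
      ultimately show ?thesis by (simp add: ereal_max[symmetric] del: ereal_max)
    qed
  qed
  have part2: "ereal (real (eig_mult E lam)) \<le> ereal (real n) / ereal (lam + 1) + ereal (real n powr \<epsilon>)"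
    if eps: "0 < \<epsilon>" "log \<Delta> (real n) \<ge> inverse \<epsilon> * (2 * lam + 2) ^ 14 * log 2 (lam + 2)" for \<epsilon>
  proof -
    consider "lam = - 1" | "- 1 < lam" "lam \<le> 0" | "lam > 0" using lam1 by linarith
    then show ?thesis
    proof cases
      case 1
      \<comment> \<open>In the extended reals a positive number divided by 0 is \<infinity>.\<close>
      then show ?thesis using n0 by (simp add: divide_ereal_def)
    next
      case 2
      have "real (eig_mult E lam) \<le> real n / 1" using mult by simp
      also have "\<dots> \<le> real n / (lam + 1)" using 2 n0 by (intro divide_left_mono) auto
      also have "\<dots> \<le> real n / (lam + 1) + real n powr \<epsilon>" by simp
      finally show ?thesis using 2 by simp
    next
      case 3
      define M where "M = (2 * lam + 2) ^ 14 * log 2 (lam + 2)"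
      \<comment> \<open>Multiplying the hypothesis by \<epsilon> and exponentiating to base \<Delta>
        turns the error term \<open>\<Delta> powr M\<close> into at most
        \<open>real n powr \<epsilon>\<close>.\<close>
      have "inverse \<epsilon> * M * \<epsilon> \<le> log \<Delta> (real n) * \<epsilon>"
        using eps by (intro mult_right_mono) (auto simp: M_def mult.assoc)
      moreover have "inverse \<epsilon> * M * \<epsilon> = M" using eps(1) by simp
      ultimately have "M \<le> log \<Delta> (real n) * \<epsilon>" by linarith
      then have "\<Delta> powr M \<le> \<Delta> powr (log \<Delta> (real n) * \<epsilon>)" using d by (intro powr_mono) auto
      also have "\<dots> = real n powr \<epsilon>" using d n0 by (simp flip: powr_powr)
      finally have "\<Delta> powr M \<le> real n powr \<epsilon>" .
      then have "real (eig_mult E lam) \<le> real n / (lam + 1) + real n powr \<epsilon>"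
        using eig_mult_second_le_quotient[OF E lam 3 deg d M_def] unfolding assms(2) by linarith
      then show ?thesis using 3 by simp
    qed
  qed
  show ?thesis using part1 part2 unfolding lam_def by blast
qed

end
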